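(* Let $\mathcal{G}$ be a bounded-degree Borel pmp graph on a standard probability space $(X,\mu)$. Then $\chi_\mu^{\mathrm{ap}}(\mathcal{G})\ge\left\lceil 1-\frac{M(T_{\mathcal{G}})}{m(T_{\mathcal{G}})}\right\rceil$.
   Context: A Borel graph on $X$ is a simple undirected graph with Borel edge set; bounded degree means degrees are uniformly bounded (up to null sets). pmp: every partial Borel bijection of $X$ whose graph is contained in the connectedness relation of $\mathcal{G}$ preserves $\mu$. $T_{\mathcal{G}}f(x)=\sum_{y\sim x}f(y)$ on $L^2(X,\mu)$; $M(T)=\sup_{f\ne0}\langle Tf,f\rangle/\langle f,f\rangle$ and $m(T)=\inf_{f\ne0}\langle Tf,f\rangle/\langle f,f\rangle$ are the maximum and minimum of the spectrum. $\chi_\mu^{\mathrm{ap}}(\mathcal{G})$ is the least $k$ such that for every $\varepsilon>0$ there is a Borel $A$ with $\mu(A)>1-\varepsilon$ such that $\mathcal{G}\restriction A$ admits a $\mu$-measurable proper $k$-coloring. *)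

theory Defs
  imports "HOL-Probability.Probability"
begin

text \<open>A Borel graph on a standard Borel space: the vertex space is a Polish space
  (type class polish_space) with its Borel sigma algebra; the graph is given by a
  symmetric irreflexive adjacency relation whose edge set is Borel.\<close>

definition borel_graph :: "'a measure \<Rightarrow> ('a \<Rightarrow> 'a \<Rightarrow> bool) \<Rightarrow> bool" where
  "borel_graph M E \<longleftrightarrow>
     (\<forall>x y. E x y \<longrightarrow> E y x) \<and> (\<forall>x. \<not> E x x) \<and>
     {(x, y). E x y} \<in> sets (M \<Otimes>\<^sub>M M)"

definition bounded_degree :: "'a measure \<Rightarrow> ('a \<Rightarrow> 'a \<Rightarrow> bool) \<Rightarrow> bool" where
  "bounded_degree M E \<longleftrightarrow>
     (\<exists>D::nat. AE x in M. finite {y. E x y} \<and> card {y. E x y} \<le> D)"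

definition partial_borel_bij :: "'a measure \<Rightarrow> ('a \<Rightarrow> 'a) \<Rightarrow> 'a set \<Rightarrow> 'a set \<Rightarrow> bool" where
  "partial_borel_bij M f A B \<longleftrightarrow>
     A \<in> sets M \<and> B \<in> sets M \<and> bij_betw f A B \<and>
     f \<in> restrict_space M A \<rightarrow>\<^sub>M M \<and>
     the_inv_into A f \<in> restrict_space M B \<rightarrow>\<^sub>M M"

definition pmp_graph :: "'a measure \<Rightarrow> ('a \<Rightarrow> 'a \<Rightarrow> bool) \<Rightarrow> bool" where
  "pmp_graph M E \<longleftrightarrow>
     (\<forall>f A B. partial_borel_bij M f A B \<and> (\<forall>x\<in>A. E\<^sup>*\<^sup>* x (f x)) \<longrightarrow>
        (\<forall>S. S \<in> sets M \<and> S \<subseteq> A \<longrightarrow> emeasure M (f ` S) = emeasure M S))"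

definition adj_op :: "('a \<Rightarrow> 'a \<Rightarrow> bool) \<Rightarrow> ('a \<Rightarrow> real) \<Rightarrow> 'a \<Rightarrow> real" where
  "adj_op E f x = (\<Sum>y\<in>{y. E x y}. f y)"

definition rayleigh_quotients :: "'a measure \<Rightarrow> ('a \<Rightarrow> 'a \<Rightarrow> bool) \<Rightarrow> real set" where
  "rayleigh_quotients M E =
     {(\<integral>x. adj_op E f x * f x \<partial>M) / (\<integral>x. (f x)\<^sup>2 \<partial>M) | f.
        f \<in> borel_measurable M \<and> integrable M (\<lambda>x. (f x)\<^sup>2) \<and> (\<integral>x. (f x)\<^sup>2 \<partial>M) \<noteq> 0}"

definition spec_max :: "'a measure \<Rightarrow> ('a \<Rightarrow> 'a \<Rightarrow> bool) \<Rightarrow> real" where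
  "spec_max M E = Sup (rayleigh_quotients M E)"

definition spec_min :: "'a measure \<Rightarrow> ('a \<Rightarrow> 'a \<Rightarrow> bool) \<Rightarrow> real" where
  "spec_min M E = Inf (rayleigh_quotients M E)"

text \<open>G restricted to A admits a mu-measurable proper k-colouring (a colouring of A that is
  measurable w.r.t. the completion of mu; it is extended by 0 outside A).\<close>
definition measurable_proper_coloring_on ::
    "'a measure \<Rightarrow> ('a \<Rightarrow> 'a \<Rightarrow> bool) \<Rightarrow> 'a set \<Rightarrow> nat \<Rightarrow> bool" where
  "measurable_proper_coloring_on M E A k \<longleftrightarrow>
     (\<exists>c::'a \<Rightarrow> nat. c \<in> completion M \<rightarrow>\<^sub>M count_space UNIV \<and>
        (\<forall>x\<in>A. c x < k) \<and> (\<forall>x\<in>A. \<forall>y\<in>A. E x y \<longrightarrow> c x \<noteq> c y))"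

definition approx_colorable :: "'a measure \<Rightarrow> ('a \<Rightarrow> 'a \<Rightarrow> bool) \<Rightarrow> nat \<Rightarrow> bool" where
  "approx_colorable M E k \<longleftrightarrow>
     (\<forall>\<epsilon>>0. \<exists>A\<in>sets M. measure M A > 1 - \<epsilon> \<and> measurable_proper_coloring_on M E A k)"

definition chi_ap :: "'a measure \<Rightarrow> ('a \<Rightarrow> 'a \<Rightarrow> bool) \<Rightarrow> nat" where
  "chi_ap M E = (LEAST k. approx_colorable M E k)"

end

(*
Hoffman's bound. Given a k-colouring of a set of almost full measure and f supported there, let h_j be f
multiplied by 1 - k on the j-th colour class. Since no edge joins points of one class,
sum_j <T h_j, h_j> = -k <T f, f> and sum_j |h_j|^2 = k (k - 1) |f|^2, so <T h_j, h_j> >= m |h_j|^2 gives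
<T f, f> <= -m (k - 1) |f|^2. Exhausting the space by coloured sets extends this to all f, so M <= -m (k - 1).

The degree bound holds only almost everywhere, so T is well defined on classes modulo null sets only
if almost no point has a neighbour in a given null set, and this needs pmp: otherwise a set of positive
measure would map along edges into a null set. Its fibres, which lie in single components, would be
atomless, and their conditional quantile functions would yield infinitely many disjoint copies of the set,
all of the same measure. Measurable selections are only needed modulo null sets; they come from the
capacitability of images of Borel sets under continuous maps. Greedy colouring shows that some number of
colours suffices, so that the LEAST in chi_ap is attained.
*)

theory Submission
  imports Defs
begin

text \<open>Degrees are finite only off a null set; a point of that null set may have uncountably
  many neighbours. A set of positive measure could therefore be sent into it along edges by a map
  \<open>f\<close> that is injective on no large piece, and then no partial bijection along edges
  detects the failure. If \<open>f\<close> were injective on a set of positive measure, pmp would be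
  contradicted at once; this is why the fibres are atomless. Two points of one fibre are joined by a
  path of length two through their common image, so rearranging the fibres stays within components,
  where pmp applies. The copies arise by sending \<open>x\<close> to the point of its own fibre at a
  quantile level that depends injectively on \<open>x\<close>; each copy uses its own interval of
  levels.

  The definition of pmp asks for Borel images and Borel inverses. Partial bijections are therefore
  used only with compact graphs, where continuity supplies both, and Borel graphs are reached by
  approximating outer measures from inside.

  The weights in the bound come from a regular simplex: for k colours, the vectors (1,...,1) - k e_a
  sum to 0, have equal norms and pairwise inner products -k.\<close>

section \<open>Borel sets as projections and capacitability\<close>

text \<open>These are the analytic sets. \<open>nat discrete\<close> carries the discrete topology,
  so the second factor is the Baire space. Closed sets upstairs are what the compactness argument
  for capacitability can handle.\<close>

definition projected_closed :: "'a::metric_space set \<Rightarrow> bool" where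
  "projected_closed S \<longleftrightarrow> (\<exists>C::('a \<times> (nat \<Rightarrow> nat discrete)) set. closed C \<and> S = fst ` C)"

lemma projected_closed_closed:
  assumes "closed S" shows "projected_closed S"
  unfolding projected_closed_def
  by (rule exI[of _ "S \<times> UNIV"]) (auto simp: assms closed_Times)

text \<open>The sequence over a point codes an index and a witness: coordinate 0 names a set
  containing the point, and the shifted sequence is a witness for that set.\<close>

lemma projected_closed_UN:
  fixes S :: "nat \<Rightarrow> 'a::metric_space set"
  assumes "\<And>n. projected_closed (S n)"
  shows "projected_closed (\<Union>n. S n)"
proof -
  obtain C :: "nat \<Rightarrow> ('a \<times> (nat \<Rightarrow> nat discrete)) set"
    where C: "\<And>n. closed (C n)" "\<And>n. S n = fst ` C n"
    using assms unfolding projected_closed_def by metis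
  define g :: "'a \<times> (nat \<Rightarrow> nat discrete) \<Rightarrow> 'a \<times> (nat \<Rightarrow> nat discrete)"
    where "g p = (fst p, \<lambda>k. snd p (Suc k))" for p
  have contg: "continuous_on UNIV g"
    unfolding g_def by (intro continuous_intros continuous_on_coordinatewise_then_product
        continuous_on_product_then_coordinatewise)
  have cont0: "continuous_on UNIV (\<lambda>p::'a \<times> (nat \<Rightarrow> nat discrete). snd p 0)"
    by (intro continuous_intros continuous_on_product_then_coordinatewise)
  \<comment> \<open>The implication from \<open>snd p 0 = discrete n\<close> to
    \<open>g p \<in> C n\<close> is written as a union of two closed sets; the first is closed
    because \<open>{discrete n}\<close> is open.\<close>
  define D where "D = (\<Inter>n. ((\<lambda>p. snd p 0) -` (- {discrete n})) \<union> (g -` C n))"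
  have "closed D"
    unfolding D_def
  proof (intro closed_INT ballI closed_Un)
    fix n
    show "closed ((\<lambda>p::'a \<times> (nat \<Rightarrow> nat discrete). snd p 0) -` (- {discrete n}))"
      by (rule closed_vimage[OF _ cont0]) (simp add: closed_def open_discrete)
    show "closed (g -` C n)"
      by (rule closed_vimage[OF C(1) contg])
  qed
  moreover have "(\<Union>n. S n) = fst ` D"
  proof (intro equalityI subsetI)
    fix x assume "x \<in> (\<Union>n. S n)"
    then obtain n z where z: "(x, z) \<in> C n"
      using C(2) by auto
    have "(x, case_nat (discrete n) z) \<in> D"
      using z by (auto simp: D_def g_def discrete_inject)
    then show "x \<in> fst ` D" by force
  next
    fix x assume "x \<in> fst ` D"
    then obtain z where z: "(x, z) \<in> D" by auto
    have "discrete (of_discrete (z 0)) = z 0"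
      by (rule of_discrete_inverse)
    then have "g (x, z) \<in> C (of_discrete (z 0))"
      using z by (auto simp: D_def)
    then show "x \<in> (\<Union>n. S n)"
      using C(2) by (force simp: g_def)
  qed
  ultimately show ?thesis unfolding projected_closed_def by blast
qed

text \<open>One sequence carries witnesses for all the sets at once, interleaved by
  \<open>prod_encode\<close>.\<close>

lemma projected_closed_INT:
  fixes S :: "nat \<Rightarrow> 'a::metric_space set"
  assumes "\<And>n. projected_closed (S n)"
  shows "projected_closed (\<Inter>n. S n)"
proof -
  obtain C :: "nat \<Rightarrow> ('a \<times> (nat \<Rightarrow> nat discrete)) set"
    where C: "\<And>n. closed (C n)" "\<And>n. S n = fst ` C n"
    using assms unfolding projected_closed_def by metis
  define g :: "nat \<Rightarrow> 'a \<times> (nat \<Rightarrow> nat discrete) \<Rightarrow> 'a \<times> (nat \<Rightarrow> nat discrete)"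
    where "g n p = (fst p, \<lambda>k. snd p (prod_encode (n, k)))" for n p
  have contg: "continuous_on UNIV (g n)" for n
    unfolding g_def by (intro continuous_intros continuous_on_coordinatewise_then_product
        continuous_on_product_then_coordinatewise)
  have "closed (\<Inter>n. g n -` C n)"
    by (intro closed_INT ballI closed_vimage C contg)
  moreover have "(\<Inter>n. S n) = fst ` (\<Inter>n. g n -` C n)"
  proof (intro equalityI subsetI)
    fix x assume "x \<in> (\<Inter>n. S n)"
    then have "\<forall>n. \<exists>z. (x, z) \<in> C n"
      unfolding C(2) by force
    then obtain z where z: "\<And>n. (x, z n) \<in> C n" by metis
    have "(x, \<lambda>i. case prod_decode i of (n, k) \<Rightarrow> z n k) \<in> (\<Inter>n. g n -` C n)"
      using z by (auto simp: g_def)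
    then show "x \<in> fst ` (\<Inter>n. g n -` C n)" by force
  next
    fix x assume "x \<in> fst ` (\<Inter>n. g n -` C n)"
    then show "x \<in> (\<Inter>n. S n)"
      using C(2) by (force simp: g_def)
  qed
  ultimately show ?thesis unfolding projected_closed_def by blast
qed

lemma projected_closed_open:
  assumes "open S" shows "projected_closed S"
proof -
  have "fsigma_in euclidean S"
    using assms by (intro open_imp_fsigma_in metrizable_space_euclidean) simp
  then obtain F where F: "\<And>n::nat. closedin euclidean (F n)" "\<Union>(range F) = S"
    unfolding fsigma_in_ascending by blast
  show ?thesis
    using projected_closed_UN[of F] projected_closed_closed[of "F _"] F by simp
qed

text \<open>Complements of analytic sets need not be analytic, so the induction over the sigma
  algebra carries the complement along; countable unions then need closure under countable
  intersections too.\<close>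

lemma projected_closed_borel:
  fixes S :: "'a::metric_space set"
  assumes "S \<in> sets borel"
  shows "projected_closed S"
proof -
  have "S \<in> sigma_sets UNIV {S. open S}"
    using assms by (simp add: borel_def)
  then have "projected_closed S \<and> projected_closed (- S)"
  proof induction
    case (Basic a)
    then show ?case by (auto intro: projected_closed_open projected_closed_closed)
  next
    case Empty
    show ?case by (auto intro: projected_closed_closed)
  next
    case (Compl a)
    then show ?case by (metis Compl_eq_Diff_UNIV double_complement)
  next
    case (Union a)
    have "- (\<Union>i. a i) = (\<Inter>i. - a i)" by auto
    then show ?case
      using projected_closed_UN[of a] projected_closed_INT[of "\<lambda>i. - a i"] Union by auto
  qed
  then show ?thesis ..
qed

section \<open>Choquet capacitability of images of closed and Borel sets\<close>

text \<open>Outer measure is not continuous along decreasing sets, so the bound is passed through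
  open sets: by compactness every open set around the image of the intersection contains the image
  of some \<open>C n\<close>, and outer regularity concludes.\<close>

lemma emeasure_compact_image_ge:
  fixes C :: "nat \<Rightarrow> 'z::{complete_space,second_countable_topology} set"
    and g :: "'z \<Rightarrow> 'x::{complete_space,second_countable_topology}"
  assumes M: "sets M = sets borel" "finite_measure M"
    and g: "continuous_on UNIV g"
    and C: "\<And>n. closed (C n)" "decseq C"
    and bdd: "\<And>n. \<exists>k. finite k \<and> C (Suc n) \<subseteq> (\<Union>x\<in>k. cball x (1 / Suc n))"
    and t: "\<And>n. t \<le> outer_measure_of M (g ` C n)"
  shows "compact (\<Inter>n. C n)" "t \<le> emeasure M (g ` (\<Inter>n. C n))"
proof -
  define F where "F = (\<Inter>n. C n)"
  \<comment> \<open>Allowing finitely many points outside each \<open>C n\<close> covers both later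
    uses: the intersection itself, and the range of a sequence with
    \<open>x n \<in> C n\<close>.\<close>
  have tb: "\<exists>k. finite k \<and> closure X \<subseteq> (\<Union>x\<in>k. ball x e)"
    if X: "\<And>n. finite (X - C n)" and e: "0 < e" for X e
  proof -
    obtain n where n: "1 / Suc n < e"
      using e by (meson nat_approx_posE)
    obtain k where k: "finite k" "C (Suc n) \<subseteq> (\<Union>x\<in>k. cball x (1 / Suc n))"
      using bdd by blast
    let ?k = "k \<union> (X - C (Suc n))"
    have fin: "finite ?k" using k X by auto
    have "X \<subseteq> (\<Union>x\<in>?k. cball x (1 / Suc n))"
      using k(2) by auto
    then have "closure X \<subseteq> (\<Union>x\<in>?k. cball x (1 / Suc n))"
      using fin by (intro closure_minimal closed_UN) auto
    also have "\<dots> \<subseteq> (\<Union>x\<in>?k. ball x e)"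
      using n by (intro UN_mono) (auto simp: mem_ball)
    finally show ?thesis using fin by blast
  qed
  have cc: "compact (closure X)" if "\<And>n. finite (X - C n)" for X
    unfolding compact_eq_totally_bounded
    using tb[OF that] by (auto simp: complete_eq_closed)
  have "closed F" unfolding F_def using C by auto
  moreover have "finite (F - C n)" for n
  proof -
    have "F - C n = {}" by (auto simp: F_def)
    then show ?thesis by (metis finite.emptyI)
  qed
  ultimately have comp: "compact F"
    using cc[of F] by (simp add: closure_closed)
  have gF: "compact (g ` F)"
    using comp g compact_continuous_image continuous_on_subset by blast
  have meas: "g ` F \<in> sets M"
    using gF M by (simp add: borel_compact)
  have *: "t \<le> emeasure M U" if U: "g ` F \<subseteq> U" "open U" for U
  proof -
    \<comment> \<open>Otherwise points \<open>x n \<in> C n\<close> with images outside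
      \<open>U\<close> would accumulate at a point of the intersection, whose image lies in
      \<open>U\<close> although the preimage of the complement of \<open>U\<close> is
      closed.\<close>
    have "\<exists>n. g ` C n \<subseteq> U"
    proof (rule ccontr)
      assume "\<not> ?thesis"
      then have "\<forall>n. \<exists>x. x \<in> C n \<and> g x \<notin> U" by blast
      then obtain x where x: "\<And>n. x n \<in> C n" "\<And>n. g (x n) \<notin> U" by metis
      have "range x - C n \<subseteq> x ` {..<n}" for n
      proof -
        have "x k \<in> C n" if "n \<le> k" for k
          using x(1)[of k] C(2) that by (auto simp: decseq_def)
        then show ?thesis by (force simp: not_le[symmetric])
      qed
      then have "finite (range x - C n)" for n
        by (meson finite_imageI finite_lessThan finite_subset)
      then have "compact (closure (range x))" by (rule cc)
      then obtain l r where l: "strict_mono r" "(x \<circ> r) \<longlonglongrightarrow> l"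
        unfolding compact_eq_seq_compact_metric seq_compact_def
        by (metis closure_subset rangeI subset_iff)
      have "l \<in> C n" for n
      proof (rule closed_sequentially[OF C(1)])
        show "(\<lambda>k. (x \<circ> r) (k + n)) \<longlonglongrightarrow> l" using l(2) by (rule LIMSEQ_ignore_initial_segment)
        fix k
        have "n \<le> r (k + n)" using seq_suble[OF l(1), of "k + n"] by simp
        then have "C (r (k + n)) \<subseteq> C n" using C(2) by (simp add: decseq_def)
        then show "(x \<circ> r) (k + n) \<in> C n" using x(1) by auto
      qed
      then have "g l \<in> U" using U by (auto simp: F_def)
      moreover have "closed (g -` (- U))"
        using U g by (intro closed_vimage) auto
      then have "l \<in> g -` (- U)"
        using closed_sequentially[OF _ _ l(2)] x(2) by auto
      ultimately show False by auto
    qed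
    then obtain n where "g ` C n \<subseteq> U" ..
    then have "outer_measure_of M (g ` C n) \<le> outer_measure_of M U"
      by (rule outer_measure_of_mono)
    then show ?thesis using t[of n] U(2) M(1) by (auto intro: order_trans)
  qed
  have "emeasure M (g ` F) = (INF U \<in> {U. g ` F \<subseteq> U \<and> open U}. emeasure M U)"
    using outer_regular[OF M(1) _ ] meas M finite_measure.emeasure_finite by (metis infinity_ennreal_def)
  also have "t \<le> \<dots>" using * by (intro INF_greatest) auto
  finally show "t \<le> emeasure M (g ` (\<Inter>n. C n))" by (simp add: F_def)
  show "compact (\<Inter>n. C n)" using comp by (simp add: F_def)
qed

text \<open>Outer measure is continuous along arbitrary increasing sets. Intersecting with finite
  unions of small balls around a dense sequence thus keeps it above \<open>t\<close> once enough
  balls are taken; repeating this with radii tending to 0 leaves a compact set.\<close>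

lemma closed_capacitable:
  fixes C :: "'z::{complete_space,second_countable_topology} set"
    and g :: "'z \<Rightarrow> 'x::{complete_space,second_countable_topology}"
  assumes M: "sets M = sets borel" "finite_measure M"
    and g: "continuous_on UNIV g" and C: "closed C"
    and t: "t < outer_measure_of M (g ` C)"
  obtains F where "compact F" "F \<subseteq> C" "t \<le> emeasure M (g ` F)"
proof -
  have sp: "space M = UNIV" using M(1) by (metis sets_eq_imp_space_eq space_borel)
  obtain X :: "'z set" where X: "countable X" "\<And>Y :: 'z set. open Y \<Longrightarrow> Y \<noteq> {} \<Longrightarrow> \<exists>d\<in>X. d \<in> Y"
    using countable_dense_setE by auto
  have step: "\<exists>D'. (closed D' \<and> t < outer_measure_of M (g ` D')) \<and> (D' \<subseteq> D \<and>
      (\<exists>k. finite k \<and> D' \<subseteq> (\<Union>x\<in>k. cball x (1 / Suc n))))"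
    if D: "closed D \<and> t < outer_measure_of M (g ` D)" for D n
  proof -
    define U where "U k = (\<Union>x\<in>from_nat_into X ` {..k}. cball x (1 / Suc n))" for k
    have U: "closed (U k)" for k
      unfolding U_def by (intro closed_UN) auto
    have inc: "incseq (\<lambda>k. g ` (D \<inter> U k))"
      unfolding incseq_def U_def by (intro allI impI image_mono Int_mono UN_mono) auto
    have "(\<Union>k. g ` (D \<inter> U k)) = g ` D"
    proof -
      have "z \<in> (\<Union>k. U k)" for z
      proof -
        obtain d where d: "d \<in> X" "d \<in> ball z (1 / Suc n)"
          using X(2)[of "ball z (1 / Suc n)"] by auto
        then have "z \<in> U (to_nat_on X d)"
          using X(1) by (auto simp: U_def dist_commute less_imp_le
              intro!: bexI[of _ "to_nat_on X d"])
        then show ?thesis by blast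
      qed
      then show ?thesis by blast
    qed
    then have "t < (SUP k. outer_measure_of M (g ` (D \<inter> U k)))"
      using SUP_outer_measure_of_incseq[OF _ inc, of M] D by (simp add: sp)
    then obtain k where k: "t < outer_measure_of M (g ` (D \<inter> U k))"
      by (auto simp: less_SUP_iff)
    show ?thesis
      apply (rule exI[of _ "D \<inter> U k"])
      using k D U[of k] by (auto simp: U_def intro!: exI[of _ "from_nat_into X ` {..k}"])
  qed
  \<comment> \<open>The clause for \<open>n = 0\<close> starts the decreasing sequence at
    \<open>C\<close>, which puts its intersection inside \<open>C\<close>.\<close>
  have "\<exists>D. \<forall>n. ((closed (D n) \<and> t < outer_measure_of M (g ` D n)) \<and> (n = 0 \<longrightarrow> D n = C)) \<and>
      (D (Suc n) \<subseteq> D n \<and> (\<exists>k. finite k \<and> D (Suc n) \<subseteq> (\<Union>x\<in>k. cball x (1 / Suc n))))"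
  proof (rule dependent_nat_choice)
    show "\<exists>D. (closed D \<and> t < outer_measure_of M (g ` D)) \<and> ((0::nat) = 0 \<longrightarrow> D = C)"
      using C t by blast
    fix D and n :: nat
    assume "(closed D \<and> t < outer_measure_of M (g ` D)) \<and> (n = 0 \<longrightarrow> D = C)"
    then show "\<exists>D'. ((closed D' \<and> t < outer_measure_of M (g ` D')) \<and> (Suc n = 0 \<longrightarrow> D' = C)) \<and>
        (D' \<subseteq> D \<and> (\<exists>k. finite k \<and> D' \<subseteq> (\<Union>x\<in>k. cball x (1 / Suc n))))"
      using step[of D n] by auto
  qed
  then obtain D where D0: "D 0 = C" and D: "\<And>n. closed (D n) \<and> t < outer_measure_of M (g ` D n)"
    and D': "\<And>n. D (Suc n) \<subseteq> D n \<and> (\<exists>k. finite k \<and> D (Suc n) \<subseteq> (\<Union>x\<in>k. cball x (1 / Suc n)))"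
    by blast
  have "decseq D" using D' by (auto intro: decseq_SucI)
  from emeasure_compact_image_ge[OF M g _ this, of t] D D'
  have "compact (\<Inter>n. D n)" "t \<le> emeasure M (g ` (\<Inter>n. D n))" by (auto intro: less_imp_le)
  moreover have "(\<Inter>n. D n) \<subseteq> C" using D0 by auto
  ultimately show thesis using that by blast
qed

text \<open>A Borel set is the projection of a closed set, so its continuous image is also a
  continuous image of a closed set.\<close>

lemma borel_image_capacitable:
  fixes S :: "'w::{complete_space,second_countable_topology} set"
    and g :: "'w \<Rightarrow> 'x::{complete_space,second_countable_topology}"
  assumes M: "sets M = sets borel" "finite_measure M"
    and g: "continuous_on UNIV g" and S: "S \<in> sets borel"
    and t: "t < outer_measure_of M (g ` S)"
  obtains F where "compact F" "F \<subseteq> S" "t \<le> emeasure M (g ` F)"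
proof -
  obtain C :: "('w \<times> (nat \<Rightarrow> nat discrete)) set" where C: "closed C" "S = fst ` C"
    using projected_closed_borel[OF S] unfolding projected_closed_def by blast
  have cont: "continuous_on UNIV (\<lambda>p. g (fst p))"
    by (intro continuous_on_compose2[OF g] continuous_intros) auto
  have "(\<lambda>p. g (fst p)) ` C = g ` S"
    unfolding C(2) image_image ..
  then obtain F where F: "compact F" "F \<subseteq> C" "t \<le> emeasure M ((\<lambda>p. g (fst p)) ` F)"
    using closed_capacitable[OF M cont C(1), of t] t by metis
  show thesis
  proof (rule that[of "fst ` F"])
    show "compact (fst ` F)"
      by (intro compact_continuous_image F continuous_intros)
    show "fst ` F \<subseteq> S" using F C by auto
    show "t \<le> emeasure M (g ` fst ` F)" using F by (simp add: image_image)
  qed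
qed

lemma outer_measure_of_null_iff:
  assumes "A \<subseteq> space M"
  shows "outer_measure_of M A = 0 \<longleftrightarrow> (\<exists>N\<in>null_sets M. A \<subseteq> N)"
proof
  assume "outer_measure_of M A = 0"
  then show "\<exists>N\<in>null_sets M. A \<subseteq> N"
    using outer_measure_of_attain[OF assms] by (auto simp: null_sets_def)
next
  assume "\<exists>N\<in>null_sets M. A \<subseteq> N"
  then obtain N where N: "N \<in> null_sets M" "A \<subseteq> N" by blast
  then have "outer_measure_of M A \<le> outer_measure_of M N"
    by (intro outer_measure_of_mono)
  then show "outer_measure_of M A = 0"
    using N by (auto simp: null_sets_def)
qed

text \<open>Up to a null set, the image agrees with a Borel hull from outside and with a countable
  union of compact images from inside. The compact sets are chosen in \<open>S\<close>, so that
  preimages are controlled as well.\<close>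

lemma borel_image_sandwich:
  fixes S :: "'w::{complete_space,second_countable_topology} set"
    and g :: "'w \<Rightarrow> 'x::{complete_space,second_countable_topology}"
  assumes M: "sets M = sets borel" "finite_measure M"
    and g: "continuous_on UNIV g" and S: "S \<in> sets borel"
  obtains F U where "\<And>n::nat. compact (F n)" "\<And>n. F n \<subseteq> S"
    "U \<in> sets M" "g ` S \<subseteq> U" "U - g ` (\<Union>n. F n) \<in> null_sets M"
proof -
  have sp: "space M = UNIV" using M(1) by (metis sets_eq_imp_space_eq space_borel)
  obtain U where U: "U \<in> sets M" "g ` S \<subseteq> U" "outer_measure_of M (g ` S) = emeasure M U"
    using outer_measure_of_attain[of "g ` S" M] by (auto simp: sp)
  have fin: "emeasure M U \<noteq> \<infinity>"
    using finite_measure.emeasure_finite[OF M(2)] by simp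
  have "\<exists>F. compact F \<and> F \<subseteq> S \<and> emeasure M U \<le> emeasure M (g ` F) + ennreal (1 / Suc n)" for n
  \<comment> \<open>A hull of measure 0 leaves no \<open>t\<close> strictly below it for
    capacitability; the empty set serves there.\<close>
  proof (cases "emeasure M U = 0")
    case True
    then show ?thesis by (intro exI[of _ "{}"]) auto
  next
    case False
    have "emeasure M U - ennreal (1 / Suc n) < emeasure M U"
      using fin False by (intro ennreal_between) (auto simp: top.not_eq_extremum zero_less_iff_neq_zero)
    then obtain F where F: "compact F" "F \<subseteq> S" "emeasure M U - ennreal (1 / Suc n) \<le> emeasure M (g ` F)"
      using borel_image_capacitable[OF M g S] U(3) by metis
    then show ?thesis
      by (auto simp: ennreal_minus_le_iff add.commute intro!: exI[of _ F])
  qed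
  then obtain F where F: "\<And>n. compact (F n)" "\<And>n. F n \<subseteq> S"
    "\<And>n. emeasure M U \<le> emeasure M (g ` F n) + ennreal (1 / Suc n)" by metis
  have cg: "compact (g ` F n)" for n
    using F(1) g compact_continuous_image continuous_on_subset by blast
  have meas: "g ` (\<Union>n. F n) \<in> sets M"
    unfolding image_UN M(1) by (intro sets.countable_UN) (auto intro: borel_compact cg)
  have sub: "g ` (\<Union>n. F n) \<subseteq> U" using F(2) U(2) by blast
  have "emeasure M U \<le> emeasure M (g ` (\<Union>n. F n)) + ennreal (1 / Suc n)" for n
  proof -
    have "emeasure M (g ` F n) \<le> emeasure M (g ` (\<Union>n. F n))"
      using meas by (intro emeasure_mono) auto
    with F(3)[of n] show ?thesis
      by (meson add_mono order.refl order_trans)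
  qed
  then have *: "\<And>n. emeasure M U \<le> emeasure M (g ` (\<Union>n. F n)) + ennreal (1 / Suc n)" .
  have "emeasure M U \<le> emeasure M (g ` (\<Union>n. F n))"
  proof (rule ennreal_le_epsilon)
    fix e :: real assume "0 < e"
    then obtain n where n: "1 / Suc n < e" by (meson nat_approx_posE)
    have "emeasure M U \<le> emeasure M (g ` (\<Union>n. F n)) + ennreal (1 / Suc n)" by (rule *)
    also have "\<dots> \<le> emeasure M (g ` (\<Union>n. F n)) + ennreal e"
      using n by (intro add_left_mono ennreal_leI) simp
    finally show "emeasure M U \<le> emeasure M (g ` (\<Union>n. F n)) + ennreal e" .
  qed
  moreover have "emeasure M (U - g ` (\<Union>n. F n)) = emeasure M U - emeasure M (g ` (\<Union>n. F n))"
    using finite_measure.emeasure_finite[OF M(2)] by (intro emeasure_Diff U meas sub) simp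
  ultimately have "emeasure M (U - g ` (\<Union>n. F n)) = 0"
    using fin by (simp add: diff_eq_0_iff_ennreal less_top)
  then have "U - g ` (\<Union>n. F n) \<in> null_sets M" using U meas by (auto simp: null_sets_def)
  then show thesis using F U by (intro that[of F U]) auto
qed

section \<open>A Borel injection into the unit interval\<close>

text \<open>Membership in the sets of a countable base is recorded by the digits 0 and 1 of a
  ternary expansion. Digits 0 and 1 in base 3 determine the expansion uniquely. Through this map,
  equality of points and the choice of a least point become Borel conditions on reals.\<close>

lemma injective_real_embedding:
  obtains \<phi> :: "'a::{second_countable_topology,t1_space} \<Rightarrow> real"
  where "\<phi> \<in> borel_measurable borel" "inj \<phi>" "\<And>x. 0 \<le> \<phi> x" "\<And>x. \<phi> x < 1"
proof -
  obtain B :: "'a set set" where B: "countable B" "\<And>C. C \<in> B \<Longrightarrow> open C"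
    "\<And>S. open S \<Longrightarrow> \<exists>U. U \<subseteq> B \<and> S = \<Union>U"
    using univ_second_countable by blast
  obtain U :: "nat \<Rightarrow> 'a set" where U: "insert {} B = range U"
    using B(1) by (metis countable_insert insert_not_empty uncountable_def)
  have Uo: "open (U n)" for n
    using B(2) U by (metis insertE open_empty rangeI)
  define a :: "'a \<Rightarrow> nat \<Rightarrow> real" where "a x n = indicator (U n) x * (1/3) ^ Suc n" for x n
  have geo: "summable (\<lambda>k. (1/3::real) ^ (Suc k + n))" for n
    unfolding power_add by (intro summable_mult2 summable_ignore_initial_segment[of _ 1, simplified] summable_geometric) simp
  have suma: "summable (a x)" for x
    by (rule summable_comparison_test'[OF geo[of 0], of 0]) (auto simp: a_def indicator_def)
  have geosum: "(\<Sum>k. (1/3::real) ^ (Suc k + n)) = (1/3) ^ n / 2" for n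
    using sums_mult2[OF geometric_sums[of "1/3::real"], of "(1/3) ^ n / 3"]
    by (simp add: sums_iff power_add)
  define \<phi> where "\<phi> x = suminf (a x)" for x
  have bit: "indicator (U n) x = (indicator (U n) y :: real)" if eq: "\<phi> x = \<phi> y" for x y n
  proof (induction n rule: less_induct)
    case (less n)
    define d where "d k = a x k - a y k" for k
    have sd: "summable d" unfolding d_def by (intro summable_diff suma)
    have "suminf d = 0"
      unfolding d_def using eq by (simp add: suminf_diff[symmetric] suma \<phi>_def)
    moreover have "d k = 0" if "k < n" for k
      using less[OF that] by (simp add: d_def a_def)
    ultimately have "(\<Sum>k. d (k + Suc n)) = - d n"
      using suminf_split_initial_segment[OF sd, of "Suc n"] by simp
    \<comment> \<open>If the digits at \<open>n\<close> differed, then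
      \<open>\<bar>d n\<bar>\<close> would be \<open>(1/3) ^ Suc n\<close>, but all later digits
      together contribute at most half of that.\<close>
    moreover have "\<bar>\<Sum>k. d (k + Suc n)\<bar> \<le> (\<Sum>k. (1/3::real) ^ (Suc k + Suc n))"
    proof -
      have *: "\<bar>d (k + Suc n)\<bar> \<le> (1/3::real) ^ (Suc k + Suc n)" for k
        by (auto simp: d_def a_def indicator_def)
      have "summable (\<lambda>k. \<bar>d (k + Suc n)\<bar>)"
        by (rule summable_comparison_test'[OF geo[of "Suc n"], of 0]) (use * in auto)
      then have "\<bar>\<Sum>k. d (k + Suc n)\<bar> \<le> (\<Sum>k. \<bar>d (k + Suc n)\<bar>)"
        by (rule summable_rabs)
      also have "\<dots> \<le> (\<Sum>k. (1/3::real) ^ (Suc k + Suc n))"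
        by (intro suminf_le * \<open>summable (\<lambda>k. \<bar>d (k + Suc n)\<bar>)\<close> geo)
      finally show ?thesis .
    qed
    ultimately have "\<bar>d n\<bar> \<le> (1/3) ^ Suc n / 2"
      using geosum[of "Suc n"] by simp
    then show ?case
      by (cases "x \<in> U n"; cases "y \<in> U n") (auto simp: d_def a_def)
  qed
  have "inj \<phi>"
  proof (rule injI, rule ccontr)
    fix x y assume xy: "\<phi> x = \<phi> y" "x \<noteq> y"
    then obtain V where V: "open V" "x \<in> V" "y \<notin> V"
      using t1_space by blast
    obtain \<W> where \<W>: "\<W> \<subseteq> B" "V = \<Union>\<W>" using B(3)[OF V(1)] by blast
    then obtain W where W: "W \<in> B" "x \<in> W" "y \<notin> W" using V by blast
    then have "W \<in> range U" using U by blast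
    then obtain n where "x \<in> U n" "y \<notin> U n"
      using W by blast
    then show False using bit[OF xy(1), of n] by simp
  qed
  moreover have "\<phi> \<in> borel_measurable borel"
    unfolding \<phi>_def a_def using Uo
    by (intro borel_measurable_suminf borel_measurable_times borel_measurable_const
        borel_measurable_indicator borel_open)
  moreover have "0 \<le> \<phi> x" for x
    unfolding \<phi>_def by (intro suminf_nonneg suma) (auto simp: a_def)
  moreover have "\<phi> x < 1" for x
  proof -
    have "\<phi> x \<le> (\<Sum>k. (1/3::real) ^ (Suc k + 0))"
      unfolding \<phi>_def by (intro suminf_le suma geo) (auto simp: a_def indicator_def)
    then show ?thesis using geosum[of 0] by simp
  qed
  ultimately show thesis by (intro that[of \<phi>])
qed

section \<open>Partial bijections along the graph\<close>

locale pmp_borel_graph = prob_space M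
  for M :: "'a::polish_space measure" +
  fixes E :: "'a \<Rightarrow> 'a \<Rightarrow> bool"
  assumes sets_M: "sets M = sets borel"
    and borel_graph: "borel_graph M E"
    and bounded_degree: "bounded_degree M E"
    and pmp: "pmp_graph M E"

text \<open>Written through the inverse of \<open>fst\<close> on \<open>F\<close>, because a
  continuous injection on a compact set has a continuous inverse.\<close>

definition graph_fun :: "('a \<times> 'b) set \<Rightarrow> 'a \<Rightarrow> 'b" where
  "graph_fun F x = snd (the_inv_into F fst x)"

lemma graph_fun_iff:
  assumes "inj_on fst F"
  shows "(x, y) \<in> F \<longleftrightarrow> x \<in> fst ` F \<and> graph_fun F x = y"
proof
  assume xy: "(x, y) \<in> F"
  then have "the_inv_into F fst x = (x, y)"
    using the_inv_into_f_f[OF assms xy] by simp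
  then show "x \<in> fst ` F \<and> graph_fun F x = y"
    using xy by (force simp: graph_fun_def)
next
  assume "x \<in> fst ` F \<and> graph_fun F x = y"
  then obtain z where z: "(x, z) \<in> F" "graph_fun F x = y" by auto
  have "the_inv_into F fst x = (x, z)"
    using the_inv_into_f_f[OF assms z(1)] by simp
  then show "(x, y) \<in> F" using z by (simp add: graph_fun_def)
qed

lemma continuous_on_graph_fun:
  fixes F :: "('a::t2_space \<times> 'b::t2_space) set"
  assumes "compact F" "inj_on fst F"
  shows "continuous_on (fst ` F) (graph_fun F)"
  unfolding graph_fun_def
  by (intro continuous_intros continuous_on_inv_into assms)

context pmp_borel_graph
begin

lemma space_M: "space M = UNIV"
  using sets_M by (metis sets_eq_imp_space_eq space_borel)

lemma finite_measure_M: "finite_measure M"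
  by (rule finite_measure_axioms)

lemma E_sym: "E x y \<Longrightarrow> E y x"
  using borel_graph by (auto simp: borel_graph_def)

lemma E_irrefl: "\<not> E x x"
  using borel_graph by (auto simp: borel_graph_def)

lemma E_borel: "{(x, y). E x y} \<in> sets borel"
proof -
  have "sets (M \<Otimes>\<^sub>M M) = sets (borel :: ('a \<times> 'a) measure)"
    unfolding borel_prod[symmetric] by (intro sets_pair_measure_cong sets_M)
  then show ?thesis using borel_graph by (auto simp: borel_graph_def)
qed

lemma measurable_M_eq [simp]: "measurable M N = measurable borel N" "measurable N M = measurable N borel"
  by (auto intro!: measurable_cong_sets simp: sets_M)

text \<open>Compactness supplies every Borel condition: both projections are compact, and the map
  and its inverse, which is the function of the swapped graph, are continuous.\<close>

lemma partial_borel_bij_graph_fun: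
  assumes F: "compact F" "inj_on fst F" "inj_on snd F"
  shows "partial_borel_bij M (graph_fun F) (fst ` F) (snd ` F)"
proof -
  let ?f = "graph_fun F" and ?A = "fst ` F" and ?B = "snd ` F"
  have c: "compact ?A" "compact ?B"
    by (intro compact_continuous_image F continuous_intros)+
  have F': "compact (prod.swap ` F)" "inj_on fst (prod.swap ` F)"
  proof -
    show "compact (prod.swap ` F)"
      using F(1) by (intro compact_continuous_image) (auto intro!: continuous_intros simp: prod.swap_def)
    show "inj_on fst (prod.swap ` F)"
      using F(3) by (auto simp: inj_on_def prod.swap_def)
  qed
  have bij: "bij_betw ?f ?A ?B"
    unfolding bij_betw_def
  proof
    show "inj_on ?f ?A"
    proof (rule inj_onI)
      fix x x' assume "x \<in> ?A" "x' \<in> ?A" "?f x = ?f x'"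
      then have "(x, ?f x) \<in> F" "(x', ?f x) \<in> F"
        using graph_fun_iff[OF F(2)] by metis+
      then show "x = x'" using inj_onD[OF F(3)] by force
    qed
    have *: "(x, y) \<in> F \<longleftrightarrow> x \<in> ?A \<and> ?f x = y" for x y
      by (rule graph_fun_iff[OF F(2)])
    show "?f ` ?A = ?B"
    proof (intro equalityI subsetI)
      fix y assume "y \<in> ?f ` ?A"
      then obtain x where "(x, y) \<in> F" using * by blast
      then show "y \<in> ?B" by force
    next
      fix y assume "y \<in> ?B"
      then obtain x where "(x, y) \<in> F" by auto
      then have "x \<in> ?A \<and> ?f x = y" using *[of x y] by simp
      then show "y \<in> ?f ` ?A" by (metis imageI)
    qed
  qed
  have inv: "the_inv_into ?A ?f y = graph_fun (prod.swap ` F) y" if "y \<in> ?B" for y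
  proof -
    obtain x where x: "(x, y) \<in> F" using \<open>y \<in> ?B\<close> by auto
    then have "x \<in> ?A" "?f x = y" using graph_fun_iff[OF F(2)] by blast+
    then have "the_inv_into ?A ?f y = x"
      using bij by (auto simp: bij_betw_def intro!: the_inv_into_f_eq)
    moreover have "(y, x) \<in> prod.swap ` F" using x by force
    then have "graph_fun (prod.swap ` F) y = x"
      using graph_fun_iff[OF F'(2)] by blast
    ultimately show ?thesis by simp
  qed
  have "continuous_on ?A ?f" by (intro continuous_on_graph_fun F)
  moreover have "continuous_on ?B (the_inv_into ?A ?f)"
  proof -
    have "fst ` prod.swap ` F = ?B" by (auto simp: image_image)
    then have "continuous_on ?B (graph_fun (prod.swap ` F))"
      using continuous_on_graph_fun[OF F'] by simp
    then show ?thesis using inv by (simp cong: continuous_on_cong)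
  qed
  moreover have "measurable (restrict_space M A) M = measurable (restrict_space borel A) borel" for A
    by (intro measurable_cong_sets sets_restrict_space_cong sets_M)
  ultimately show ?thesis
    unfolding partial_borel_bij_def
    using bij c by (auto simp: sets_M borel_compact intro!: borel_measurable_continuous_on_restrict)
qed

lemma emeasure_graph_fun_image:
  assumes F: "compact F" "inj_on fst F" "inj_on snd F" "\<And>x y. (x, y) \<in> F \<Longrightarrow> E\<^sup>*\<^sup>* x y"
    and S: "S \<in> sets M" "S \<subseteq> fst ` F"
  shows "emeasure M (graph_fun F ` S) = emeasure M S"
proof -
  have "\<forall>x\<in>fst ` F. E\<^sup>*\<^sup>* x (graph_fun F x)"
    using F(4) graph_fun_iff[OF F(2)] by blast
  then show ?thesis
    using pmp partial_borel_bij_graph_fun[OF F(1,2,3)] S unfolding pmp_graph_def by blast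
qed

lemma emeasure_fst_eq_snd_compact:
  assumes F: "compact F" "inj_on fst F" "inj_on snd F" "\<And>x y. (x, y) \<in> F \<Longrightarrow> E\<^sup>*\<^sup>* x y"
  shows "emeasure M (fst ` F) = emeasure M (snd ` F)"
proof -
  have "compact (fst ` F)"
    by (intro compact_continuous_image F continuous_intros)
  then have "fst ` F \<in> sets M" by (simp add: sets_M borel_compact)
  moreover have "graph_fun F ` fst ` F = snd ` F"
    using partial_borel_bij_graph_fun[OF F(1,2,3)] by (auto simp: partial_borel_bij_def bij_betw_def)
  ultimately show ?thesis
    using emeasure_graph_fun_image[OF F, of "fst ` F"] by simp
qed

text \<open>Either projection is approximated in outer measure by that of a compact subset
  \<open>F\<close> of \<open>S\<close>; the pmp property gives the other projection of
  \<open>F\<close> the same measure, and this lies below the other outer measure.\<close>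

lemma outer_measure_fst_eq_snd:
  assumes S: "S \<in> sets borel" "inj_on fst S" "inj_on snd S" "\<And>x y. (x, y) \<in> S \<Longrightarrow> E\<^sup>*\<^sup>* x y"
  shows "outer_measure_of M (fst ` S) = outer_measure_of M (snd ` S)"
proof -
  have le: "outer_measure_of M (fst ` F) \<le> outer_measure_of M (fst ` S)"
     "outer_measure_of M (snd ` F) \<le> outer_measure_of M (snd ` S)" if "F \<subseteq> S" for F
    using that by (auto intro!: outer_measure_of_mono)
  have eq: "emeasure M (fst ` F) = emeasure M (snd ` F)" 
     "outer_measure_of M (fst ` F) = emeasure M (fst ` F)" 
     "outer_measure_of M (snd ` F) = emeasure M (snd ` F)" if "F \<subseteq> S" "compact F" for F
  proof -
    have "compact (fst ` F)" "compact (snd ` F)"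
      by (intro compact_continuous_image that continuous_intros)+
    then show "outer_measure_of M (fst ` F) = emeasure M (fst ` F)" 
     "outer_measure_of M (snd ` F) = emeasure M (snd ` F)" by (simp_all add: sets_M borel_compact)
    show "emeasure M (fst ` F) = emeasure M (snd ` F)"
      using that S by (intro emeasure_fst_eq_snd_compact) (auto intro: inj_on_subset)
  qed
  have "t \<le> outer_measure_of M (snd ` S)" if t: "t < outer_measure_of M (fst ` S)" for t
  proof -
    have "continuous_on UNIV (fst :: 'a \<times> 'a \<Rightarrow> 'a)" by (intro continuous_intros)
    then obtain F where F: "compact F" "F \<subseteq> S" "t \<le> emeasure M (fst ` F)"
      using borel_image_capacitable[OF sets_M finite_measure_M _ S(1) t] by blast
    then show ?thesis using le(2)[of F] eq[of F] by auto
  qed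
  moreover have "t \<le> outer_measure_of M (fst ` S)" if t: "t < outer_measure_of M (snd ` S)" for t
  proof -
    have "continuous_on UNIV (snd :: 'a \<times> 'a \<Rightarrow> 'a)" by (intro continuous_intros)
    then obtain F where F: "compact F" "F \<subseteq> S" "t \<le> emeasure M (snd ` F)"
      using borel_image_capacitable[OF sets_M finite_measure_M _ S(1) t] by blast
    then show ?thesis using le(1)[of F] eq[of F] by auto
  qed
  ultimately show ?thesis
    by (meson antisym dense_le)
qed

section \<open>Measurable selection up to null sets\<close>

lemma borel_projection_null:
  fixes S :: "('a \<times> 'b::{complete_space,second_countable_topology}) set"
  assumes "S \<in> sets borel"
  obtains U N where "U \<in> sets M" "fst ` S \<subseteq> U" "N \<in> null_sets M" "U - fst ` S \<subseteq> N"
proof -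
  have "continuous_on UNIV (fst :: 'a \<times> 'b \<Rightarrow> 'a)" by (intro continuous_intros)
  then obtain F U where F: "\<And>n::nat. compact (F n)" "\<And>n. F n \<subseteq> S"
    "U \<in> sets M" "fst ` S \<subseteq> U" "U - fst ` (\<Union>n. F n) \<in> null_sets M"
    using borel_image_sandwich[OF sets_M finite_measure_M _ assms] by metis
  moreover have "U - fst ` S \<subseteq> U - fst ` (\<Union>n. F n)" using F(2) by blast
  ultimately show thesis by (intro that)
qed

text \<open>Picks the point of each section that is least for an injection into the reals; the
  section is only known to be nonempty below a rational bound up to a null set.\<close>

lemma borel_section_ae:
  assumes S: "(S :: ('a \<times> 'a) set) \<in> sets borel"
  obtains T N where "T \<in> sets borel" "T \<subseteq> S" "inj_on fst T" "N \<in> null_sets M"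
    "\<And>x. x \<notin> N \<Longrightarrow> finite {y. (x, y) \<in> S} \<Longrightarrow> {y. (x, y) \<in> S} \<noteq> {} \<Longrightarrow> \<exists>y. (x, y) \<in> T"
proof -
  obtain \<phi> :: "'a \<Rightarrow> real" where \<phi>: "\<phi> \<in> borel_measurable borel" "inj \<phi>"
    by (rule injective_real_embedding)
  have [measurable]: "\<phi> \<in> borel_measurable borel" by fact
  have [measurable]: "S \<in> sets (borel \<Otimes>\<^sub>M borel)"
    using S by (metis borel_prod)
  define Sq where "Sq q = {p\<in>S. \<phi> (snd p) < of_rat q}" for q :: rat
  have "Sq q = {p\<in>space (borel \<Otimes>\<^sub>M borel). p \<in> S \<and> \<phi> (snd p) < of_rat q}" for q
    by (auto simp: Sq_def space_pair_measure)
  then have "Sq q \<in> sets (borel \<Otimes>\<^sub>M borel)" for q by simp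
  then have "Sq q \<in> sets borel" for q by (metis borel_prod)
  then have "\<exists>U N. U \<in> sets M \<and> fst ` Sq q \<subseteq> U \<and> N \<in> null_sets M \<and> U - fst ` Sq q \<subseteq> N" for q
    using borel_projection_null by metis
  then obtain U N where U: "\<And>q. U q \<in> sets M" "\<And>q. fst ` Sq q \<subseteq> U q"
    and N: "\<And>q. N q \<in> null_sets M" "\<And>q. U q - fst ` Sq q \<subseteq> N q" by metis
  have [measurable]: "U q \<in> sets borel" for q using U(1) sets_M by simp
  \<comment> \<open>\<open>U q\<close> contains the projection of \<open>Sq q\<close> everywhere,
    which makes \<open>T\<close> single-valued at every point. It exceeds that projection only
    inside \<open>N q\<close>, and only the existence of a chosen point has to avoid
    \<open>N q\<close>.\<close>
  define T where "T = {p\<in>S. \<forall>q. fst p \<in> U q \<longrightarrow> \<phi> (snd p) \<le> of_rat q}"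
  have "T = {p\<in>space (borel \<Otimes>\<^sub>M borel). p \<in> S \<and> (\<forall>q. fst p \<in> U q \<longrightarrow> \<phi> (snd p) \<le> of_rat q)}"
    by (auto simp: T_def space_pair_measure)
  also have "\<dots> \<in> sets (borel \<Otimes>\<^sub>M borel)" by measurable
  finally have "T \<in> sets borel" by (metis borel_prod)
  moreover have "T \<subseteq> S" by (auto simp: T_def)
  moreover have "inj_on fst T"
  proof -
    have *: "\<not> \<phi> y < \<phi> z" if T: "(x, y) \<in> T" "(x, z) \<in> T" for x y z
    proof
      assume "\<phi> y < \<phi> z"
      then obtain q where q: "\<phi> y < of_rat q" "of_rat q < \<phi> z"
        using of_rat_dense by blast
      then have "(x, y) \<in> Sq q" using T by (auto simp: Sq_def T_def)
      then have "x \<in> U q" using U(2) by force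
      then show False using T(2) q by (auto simp: T_def)
    qed
    show ?thesis
    proof (rule inj_onI)
      fix p p' assume p: "p \<in> T" "p' \<in> T" "fst p = fst p'"
      then have "\<phi> (snd p) = \<phi> (snd p')"
        using *[of "fst p" "snd p" "snd p'"] *[of "fst p" "snd p'" "snd p"] by (metis linorder_less_linear prod.collapse)
      then show "p = p'" using p(3) \<phi>(2) by (auto simp: inj_def prod_eq_iff)
    qed
  qed
  moreover have "(\<Union>q. N q) \<in> null_sets M" using N(1) by (intro null_sets_UN) auto
  moreover have "\<exists>y. (x, y) \<in> T"
    if x: "x \<notin> (\<Union>q. N q)" and fin: "finite {y. (x, y) \<in> S}" "{y. (x, y) \<in> S} \<noteq> {}" for x
  proof -
    obtain y where y: "(x, y) \<in> S" "\<And>z. (x, z) \<in> S \<Longrightarrow> \<phi> y \<le> \<phi> z"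
      using ex_min_if_finite[of "\<phi> ` {y. (x, y) \<in> S}"] fin by fastforce
    have "\<phi> y \<le> of_rat q" if "x \<in> U q" for q
    proof -
      have "x \<in> fst ` Sq q" using that x N(2)[of q] by blast
      then show ?thesis using y(2) by (force simp: Sq_def)
    qed
    then have "(x, y) \<in> T" using y(1) by (auto simp: T_def)
    then show ?thesis ..
  qed
  ultimately show thesis by (rule that)
qed

text \<open>Selections are removed one after another. Off a null set each round takes a point from
  every nonempty section, and a finite section is exhausted after finitely many rounds.\<close>

lemma borel_uniformization_ae:
  assumes S: "(S :: ('a \<times> 'a) set) \<in> sets borel"
    and fin: "AE x in M. finite {y. (x, y) \<in> S}"
  obtains T N where "\<And>n::nat. T n \<in> sets borel" "\<And>n. T n \<subseteq> S" "\<And>n. inj_on fst (T n)" "N \<in> null_sets M"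
    "\<And>x y. x \<notin> N \<Longrightarrow> (x, y) \<in> S \<Longrightarrow> \<exists>n. (x, y) \<in> T n"
proof -
  obtain N0 where N0: "N0 \<in> null_sets M" "\<And>x. x \<notin> N0 \<Longrightarrow> finite {y. (x, y) \<in> S}"
    using fin by (auto simp: eventually_ae_filter space_M)
  \<comment> \<open>The selection and its null set are chosen as functions of the Borel set, so that
    the removal can be iterated.\<close>
  have "\<forall>S::('a \<times> 'a) set. \<exists>T N. S \<in> sets borel \<longrightarrow> T \<in> sets borel \<and> T \<subseteq> S \<and> inj_on fst T \<and> N \<in> null_sets M \<and>
    (\<forall>x. x \<notin> N \<longrightarrow> finite {y. (x, y) \<in> S} \<longrightarrow> {y. (x, y) \<in> S} \<noteq> {} \<longrightarrow> (\<exists>y. (x, y) \<in> T))"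
    using borel_section_ae by metis
  then obtain \<tau> \<nu> where \<tau>: "\<And>S::('a \<times> 'a) set. S \<in> sets borel \<Longrightarrow> \<tau> S \<in> sets borel \<and> \<tau> S \<subseteq> S \<and> inj_on fst (\<tau> S) \<and>
     \<nu> S \<in> null_sets M \<and>
    (\<forall>x. x \<notin> \<nu> S \<longrightarrow> finite {y. (x, y) \<in> S} \<longrightarrow> {y. (x, y) \<in> S} \<noteq> {} \<longrightarrow> (\<exists>y. (x, y) \<in> \<tau> S))"
    by metis
  define R where "R n = ((\<lambda>R. R - \<tau> R) ^^ n) S" for n :: nat
  have R0: "R 0 = S" and RSuc: "R (Suc n) = R n - \<tau> (R n)" for n by (simp_all add: R_def)
  have R: "R n \<in> sets borel" for n
    by (induction n) (use S \<tau> in \<open>auto simp: R0 RSuc\<close>)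
  have RS: "R n \<subseteq> S" for n by (induction n) (auto simp: R0 RSuc)
  let ?N = "N0 \<union> (\<Union>n. \<nu> (R n))"
  show thesis
  proof (rule that[of "\<lambda>n. \<tau> (R n)" ?N])
    show "\<tau> (R n) \<in> sets borel" "inj_on fst (\<tau> (R n))" for n
      using \<tau>[OF R] by auto
    show "\<tau> (R n) \<subseteq> S" for n using \<tau>[OF R] RS by blast
    show "?N \<in> null_sets M"
      using \<tau>[OF R] N0 by (intro null_sets.Un null_sets_UN) auto
    fix x y assume x: "x \<notin> ?N" and xy: "(x, y) \<in> S"
    show "\<exists>n. (x, y) \<in> \<tau> (R n)"
    proof (rule ccontr)
      assume neg: "\<not> ?thesis"
      have y: "(x, y) \<in> R n" for n
        by (induction n) (use xy neg in \<open>auto simp: R0 RSuc\<close>)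
      have fin: "finite {y. (x, y) \<in> R n}" for n
        using N0(2)[of x] x RS[of n] by (auto elim!: rev_finite_subset)
      have less: "card {y. (x, y) \<in> R (Suc n)} < card {y. (x, y) \<in> R n}" for n
      proof (rule psubset_card_mono[OF fin])
        obtain z where "(x, z) \<in> \<tau> (R n)"
          using \<tau>[OF R[of n]] x fin[of n] y[of n] by blast
        moreover have "\<tau> (R n) \<subseteq> R n" using \<tau>[OF R] by blast
        ultimately show "{y. (x, y) \<in> R (Suc n)} \<subset> {y. (x, y) \<in> R n}"
          by (auto simp: RSuc)
      qed
      have "card {y. (x, y) \<in> R n} + n \<le> card {y. (x, y) \<in> R 0}" for n
      proof (induction n)
        case (Suc n)
        then show ?case
          using less[of n] by linarith
      qed simp
      from this[of "Suc (card {y. (x, y) \<in> R 0})"] show False by simp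
    qed
  qed
qed

lemma AE_finite_degree: "AE x in M. finite {y. E x y}"
  using bounded_degree by (auto simp: bounded_degree_def)

end

section \<open>Conditional distributions along fibres\<close>

text \<open>A failure is localized between two rationals \<open>r\<close> and \<open>s\<close> on a
  set \<open>C r s\<close> of positive measure. On it \<open>h2\<close> is at most \<open>r\<close>,
  so the contradiction compares finite numbers.\<close>

lemma AE_le_of_nn_integral_le:
  assumes "finite_measure N" and [measurable]: "h1 \<in> borel_measurable N" "h2 \<in> borel_measurable N" "B \<in> sets N"
    and le: "\<And>D. D \<in> sets N \<Longrightarrow> D \<subseteq> B \<Longrightarrow> (\<integral>\<^sup>+x\<in>D. h1 x \<partial>N) \<le> (\<integral>\<^sup>+x\<in>D. h2 x \<partial>N)"
  shows "AE x in N. x \<in> B \<longrightarrow> h1 x \<le> h2 x"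
proof -
  interpret finite_measure N by fact
  define C where "C r s = {x\<in>space N. x \<in> B \<and> h2 x \<le> ennreal (of_rat r) \<and> ennreal (of_rat s) \<le> h1 x}" for r s
  have C [measurable]: "C r s \<in> sets N" for r s unfolding C_def by measurable
  have null: "C r s \<in> null_sets N" if rs: "ennreal (of_rat r) < ennreal (of_rat s)" for r s
  proof (rule ccontr)
    assume "C r s \<notin> null_sets N"
    then have pos: "0 < emeasure N (C r s)" by (auto simp: null_sets_def zero_less_iff_neq_zero)
    have "ennreal (of_rat s) * emeasure N (C r s) = (\<integral>\<^sup>+x\<in>C r s. ennreal (of_rat s) \<partial>N)"
      by (rule nn_integral_cmult_indicator[OF C, symmetric])
    also have "\<dots> \<le> (\<integral>\<^sup>+x\<in>C r s. h1 x \<partial>N)"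
      by (intro nn_integral_mono) (auto simp: C_def indicator_def)
    also have "\<dots> \<le> (\<integral>\<^sup>+x\<in>C r s. h2 x \<partial>N)"
      by (intro le) (auto simp: C_def)
    also have "\<dots> \<le> (\<integral>\<^sup>+x\<in>C r s. ennreal (of_rat r) \<partial>N)"
      by (intro nn_integral_mono) (auto simp: C_def indicator_def)
    also have "\<dots> = ennreal (of_rat r) * emeasure N (C r s)"
      by (rule nn_integral_cmult_indicator[OF C])
    also have "\<dots> < ennreal (of_rat s) * emeasure N (C r s)"
      using rs pos by (intro ennreal_mult_strict_right_mono) (auto simp: less_top[symmetric])
    finally show False by simp
  qed
  have "AE x in N. \<forall>r s. ennreal (of_rat r) < ennreal (of_rat s) \<longrightarrow> x \<notin> C r s"
    unfolding AE_all_countable using null by (auto intro: AE_not_in)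
  with AE_space show ?thesis
  proof eventually_elim
    case (elim x)
    show ?case
    proof (rule impI, rule ccontr)
      assume x: "x \<in> B" "\<not> h1 x \<le> h2 x"
      then obtain r where r: "h2 x < ennreal (of_rat r)" "ennreal (of_rat r) < h1 x"
        using ennreal_rat_dense[of "h2 x" "h1 x"] by (auto simp: not_le)
      then obtain s where s: "ennreal (of_rat r) < ennreal (of_rat s)" "ennreal (of_rat s) < h1 x"
        using ennreal_rat_dense by blast
      then have "x \<in> C r s" using x r elim by (auto simp: C_def less_imp_le)
      then show False using elim s by blast
    qed
  qed
qed

text \<open>\<open>h q y\<close> is the conditional probability of \<phi> being at most
  \<open>q\<close> given that \<open>f\<close> takes the value \<open>y\<close>, obtained as a
  Radon-Nikodym derivative. Each derivative is fixed only up to a null set; with rational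
  \<open>q\<close> there are countably many of them.\<close>

lemma conditional_cdf_exists:
  fixes f :: "'a \<Rightarrow> 'b::topological_space" and \<phi> :: "'a \<Rightarrow> real"
  assumes M: "finite_measure M" and [measurable]: "f \<in> M \<rightarrow>\<^sub>M borel" "\<phi> \<in> borel_measurable M"
  obtains h :: "rat \<Rightarrow> 'b \<Rightarrow> ennreal" where "\<And>q. h q \<in> borel_measurable borel"
    "\<And>q D. D \<in> sets borel \<Longrightarrow> (\<integral>\<^sup>+y\<in>D. h q y \<partial>distr M borel f)
        = emeasure M {x\<in>space M. f x \<in> D \<and> \<phi> x \<le> of_rat q}"
proof -
  interpret finite_measure M by fact
  interpret N: finite_measure "distr M borel f" by (rule finite_measure_distr) simp
  have "\<exists>h\<in>borel_measurable borel. \<forall>D\<in>sets borel. (\<integral>\<^sup>+y\<in>D. h y \<partial>distr M borel f)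
        = emeasure M {x\<in>space M. f x \<in> D \<and> \<phi> x \<le> of_rat q}" for q
  proof -
    define Mq where "Mq = density M (indicator {x\<in>space M. \<phi> x \<le> of_rat q})"
    have emq: "emeasure (distr Mq borel f) D = emeasure M {x\<in>space M. f x \<in> D \<and> \<phi> x \<le> of_rat q}"
      if "D \<in> sets borel" for D
    proof -
      have [measurable]: "D \<in> sets borel" by fact
      have "emeasure (distr Mq borel f) D = emeasure Mq (f -` D \<inter> space M)"
        by (subst emeasure_distr) (auto simp: Mq_def)
      also have "\<dots> = emeasure M ({x\<in>space M. \<phi> x \<le> of_rat q} \<inter> (f -` D \<inter> space M))"
        unfolding Mq_def by (rule emeasure_restricted) measurable
      also have "{x\<in>space M. \<phi> x \<le> of_rat q} \<inter> (f -` D \<inter> space M) = {x\<in>space M. f x \<in> D \<and> \<phi> x \<le> of_rat q}"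
        by auto
      finally show ?thesis .
    qed
    have "absolutely_continuous (distr M borel f) (distr Mq borel f)"
      unfolding absolutely_continuous_def
    proof
      fix D assume D: "D \<in> null_sets (distr M borel f)"
      then have [measurable]: "D \<in> sets borel" by auto
      have "emeasure M {x\<in>space M. f x \<in> D \<and> \<phi> x \<le> of_rat q} \<le> emeasure M (f -` D \<inter> space M)"
        by (intro emeasure_mono) auto
      also have "\<dots> = 0" using D by (auto simp: null_sets_def emeasure_distr)
      finally show "D \<in> null_sets (distr Mq borel f)"
        by (auto simp: null_sets_def emq)
    qed
    then obtain h where h: "h \<in> borel_measurable borel" "density (distr M borel f) h = distr Mq borel f"
      using N.Radon_Nikodym[of "distr Mq borel f"] by auto
    have "(\<integral>\<^sup>+y\<in>D. h y \<partial>distr M borel f) = emeasure M {x\<in>space M. f x \<in> D \<and> \<phi> x \<le> of_rat q}"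
      if "D \<in> sets borel" for D
    proof -
      have "(\<integral>\<^sup>+y\<in>D. h y \<partial>distr M borel f) = emeasure (density (distr M borel f) h) D"
        using h(1) that by (intro emeasure_density[symmetric]) auto
      then show ?thesis using emq[OF that] h(2) by simp
    qed
    then show ?thesis using h(1) by blast
  qed
  then have "\<forall>q. \<exists>h. h \<in> borel_measurable borel \<and> (\<forall>D\<in>sets borel. (\<integral>\<^sup>+y\<in>D. h y \<partial>distr M borel f)
        = emeasure M {x\<in>space M. f x \<in> D \<and> \<phi> x \<le> of_rat q})" by blast
  from choice[OF this] show thesis using that by blast
qed

text \<open>If the conditional distribution functions jumped over the interval from \<open>s\<close> to \<open>t\<close> on a set
  of positive measure, then the jump points would form a set of positive measure on which \<open>f\<close> is injective.\<close>

lemma conditional_cdf_no_jump: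
  fixes f :: "'a \<Rightarrow> 'b::topological_space" and \<phi> :: "'a \<Rightarrow> real" and h :: "rat \<Rightarrow> 'b \<Rightarrow> ennreal"
  assumes M: "finite_measure M" "space M = UNIV" and [measurable]: "f \<in> M \<rightarrow>\<^sub>M borel" "\<phi> \<in> borel_measurable M"
    and h [measurable]: "\<And>q. h q \<in> borel_measurable borel"
    and hint: "\<And>q D. D \<in> sets borel \<Longrightarrow> (\<integral>\<^sup>+y\<in>D. h q y \<partial>distr M borel f)
        = emeasure M {x. f x \<in> D \<and> \<phi> x \<le> of_rat q}"
    and D [measurable]: "D \<in> sets borel"
    and mono: "\<And>p q y. y \<in> D \<Longrightarrow> p \<le> q \<Longrightarrow> h p y \<le> h q y"
    and neg: "\<And>q y. y \<in> D \<Longrightarrow> q < 0 \<Longrightarrow> h q y = 0" and one: "\<And>y. y \<in> D \<Longrightarrow> 1 \<le> h 1 y"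
    and st: "0 < s" "s < t" "t \<le> 1"
    and gap: "\<And>y q. y \<in> D \<Longrightarrow> h q y < ennreal s \<or> ennreal t \<le> h q y"
    and \<phi>: "inj \<phi>" and inj: "\<And>W. W \<in> sets M \<Longrightarrow> inj_on f W \<Longrightarrow> emeasure M W = 0"
  shows "emeasure M (f -` D) = 0"
proof -
  interpret finite_measure M by fact
  \<comment> \<open>\<open>V n\<close> holds the points \<open>x\<close> for which \<phi>
    \<open>x\<close> is within 1/(n+1) of the jump in the fibre of \<open>x\<close>.\<close>
  define V where "V n = {x. f x \<in> D \<and> (\<forall>q. (\<phi> x + 1 / Suc n < of_rat q \<longrightarrow> ennreal t \<le> h q (f x)) \<and>
      (of_rat q < \<phi> x - 1 / Suc n \<longrightarrow> h q (f x) < ennreal s))}" for n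
  have "V n = {x\<in>space M. f x \<in> D \<and> (\<forall>q. (\<phi> x + 1 / Suc n < of_rat q \<longrightarrow> ennreal t \<le> h q (f x)) \<and>
      (of_rat q < \<phi> x - 1 / Suc n \<longrightarrow> h q (f x) < ennreal s))}" for n
    unfolding V_def M by simp
  then have [measurable]: "V n \<in> sets M" for n by simp
  have fD: "f -` B \<in> sets M" if "B \<in> sets borel" for B
    using measurable_sets[OF \<open>f \<in> M \<rightarrow>\<^sub>M borel\<close> that] M by simp
  have dec: "decseq V"
  proof (rule decseq_SucI)
    fix n
    have "1 / real (Suc (Suc n)) \<le> 1 / Suc n" by (simp add: field_simps)
    then show "V (Suc n) \<subseteq> V n"
      unfolding V_def by (auto intro: le_less_trans less_le_trans; smt (verit))
  qed
  \<comment> \<open>The jump carries at least the share \<open>t - s\<close> of the mass of each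
    fibre, however small a neighbourhood of it is taken.\<close>
  have big: "(t - s) * measure M (f -` D) \<le> measure M (V n)" for n
  proof -
    \<comment> \<open>A grid of step 1/(n+1) that starts at -1/(n+1), where \<open>h\<close>
      vanishes, and reaches 1 at index n + 2, where \<open>h\<close> is at least 1; so the jump of
      every fibre over \<open>D\<close> falls into one of its cells.\<close>
    define a where "a i = of_nat i / of_nat (Suc n) - (1 / of_nat (Suc n) :: rat)" for i
    have aSuc: "a (Suc i) = a i + 1 / of_nat (Suc n)" for i
      by (simp add: a_def add_divide_distrib)
    have amono: "a i \<le> a j" if "i \<le> j" for i j
      using that by (simp add: a_def divide_right_mono)
    have raSuc: "real_of_rat (a (Suc i)) = of_rat (a i) + 1 / Suc n" for i
      unfolding aSuc by (simp add: of_rat_add of_rat_divide)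
    define C where "C i = {y\<in>D. h (a i) y < ennreal s \<and> ennreal t \<le> h (a (Suc i)) y}" for i
    have "C i = {y\<in>space borel. y \<in> D \<and> h (a i) y < ennreal s \<and> ennreal t \<le> h (a (Suc i)) y}" for i
      by (auto simp: C_def)
    then have C [measurable]: "C i \<in> sets borel" for i by simp
    have Cdisj: "C i \<inter> C j = {}" if "i < j" for i j
    proof (rule ccontr)
      assume "C i \<inter> C j \<noteq> {}"
      then obtain y where y: "y \<in> D" "ennreal t \<le> h (a (Suc i)) y" "h (a j) y < ennreal s"
        by (auto simp: C_def)
      have "h (a (Suc i)) y \<le> h (a j) y"
        using y(1) amono[of "Suc i" j] that by (intro mono) auto
      then have "ennreal t < ennreal s" using y by (meson le_less_trans order_trans)
      then show False using st by (simp add: ennreal_less_iff)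
    qed
    have Ccover: "D = (\<Union>i\<in>{..Suc n}. C i)"
    proof (intro equalityI subsetI)
      fix y assume y: "y \<in> D"
      have "a 0 < 0" by (simp add: a_def)
      then have "\<not> ennreal t \<le> h (a 0) y" using neg[OF y] st by (simp add: ennreal_le_iff2)
      moreover have "a (Suc (Suc n)) = (of_nat (Suc n) :: rat) / of_nat (Suc n)"
        unfolding a_def diff_divide_distrib[symmetric] by simp
      then have "a (Suc (Suc n)) = 1" by (simp del: of_nat_Suc)
      then have "ennreal t \<le> h (a (Suc (Suc n))) y"
        using one[OF y] st by (metis ennreal_1 ennreal_leI order_trans)
      ultimately obtain k where "k < Suc (Suc n)" "\<forall>i\<le>k. \<not> ennreal t \<le> h (a i) y" "ennreal t \<le> h (a (Suc k)) y"
        using ex_least_nat_less[of "\<lambda>i. ennreal t \<le> h (a i) y" "Suc (Suc n)"] by blast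
      then show "y \<in> (\<Union>i\<in>{..Suc n}. C i)"
        using gap[OF y] y by (auto simp: C_def intro!: bexI[of _ k])
    qed (auto simp: C_def)
    \<comment> \<open>\<open>X i\<close> keeps from the fibres over \<open>C i\<close> only the
      points at the height of the cell with the jump; its measure is the difference of the masses
      below the two ends of the cell.\<close>
    define X where "X i = {x. f x \<in> C i \<and> of_rat (a i) < \<phi> x \<and> \<phi> x \<le> of_rat (a (Suc i))}" for i
    have "X i = {x\<in>space M. f x \<in> C i \<and> of_rat (a i) < \<phi> x \<and> \<phi> x \<le> of_rat (a (Suc i))}" for i
      unfolding X_def M by simp
    then have X [measurable]: "X i \<in> sets M" for i by simp
    have XV: "X i \<subseteq> V n" for i
    proof
      fix x assume "x \<in> X i"
      then have x: "f x \<in> D" "h (a i) (f x) < ennreal s" "ennreal t \<le> h (a (Suc i)) (f x)"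
        "of_rat (a i) < \<phi> x" "\<phi> x \<le> of_rat (a (Suc i))"
        by (auto simp: X_def C_def)
      have "ennreal t \<le> h q (f x)" if "\<phi> x + 1 / Suc n < of_rat q" for q
      proof -
        have "real_of_rat (a (Suc i)) < of_rat q" using that x raSuc[of i] by linarith
        then have "h (a (Suc i)) (f x) \<le> h q (f x)" using x(1) by (intro mono) (auto simp: of_rat_less)
        then show ?thesis using x by (meson order_trans)
      qed
      moreover have "h q (f x) < ennreal s" if "of_rat q < \<phi> x - 1 / Suc n" for q
      proof -
        have "real_of_rat q < of_rat (a i)" using that x raSuc[of i] by linarith
        then have "h q (f x) \<le> h (a i) (f x)" using x(1) by (intro mono) (auto simp: of_rat_less)
        then show ?thesis using x by (meson le_less_trans)
      qed
      ultimately show "x \<in> V n" using x by (auto simp: V_def)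
    qed
    have Xbig: "(t - s) * measure M (f -` C i) \<le> measure M (X i)" for i
    proof -
      define Y where "Y q = {x. f x \<in> C i \<and> \<phi> x \<le> of_rat q}" for q
      have "Y q = {x\<in>space M. f x \<in> C i \<and> \<phi> x \<le> of_rat q}" for q
        unfolding Y_def M by simp
      then have Y [measurable]: "Y q \<in> sets M" for q by simp
      have c: "(\<integral>\<^sup>+y\<in>C i. ennreal c \<partial>distr M borel f) = ennreal (c * measure M (f -` C i))" if "0 \<le> c" for c
      proof -
        have "(\<integral>\<^sup>+y\<in>C i. ennreal c \<partial>distr M borel f) = ennreal c * emeasure (distr M borel f) (C i)"
          by (rule nn_integral_cmult_indicator) simp
        also have "emeasure (distr M borel f) (C i) = measure M (f -` C i)"
          by (simp add: emeasure_distr M emeasure_eq_measure)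
        finally show ?thesis using that by (simp add: ennreal_mult)
      qed
      have "ennreal (t * measure M (f -` C i)) \<le> (\<integral>\<^sup>+y\<in>C i. h (a (Suc i)) y \<partial>distr M borel f)"
        using st by (subst c[symmetric]) (auto intro!: nn_integral_mono simp: C_def indicator_def)
      also have "\<dots> = ennreal (measure M (Y (a (Suc i))))"
        unfolding hint[OF C] Y_def[symmetric] by (rule emeasure_eq_measure)
      finally have 1: "t * measure M (f -` C i) \<le> measure M (Y (a (Suc i)))"
        by simp
      have "ennreal (measure M (Y (a i))) = (\<integral>\<^sup>+y\<in>C i. h (a i) y \<partial>distr M borel f)"
        unfolding hint[OF C] Y_def[symmetric] by (rule emeasure_eq_measure[symmetric])
      also have "\<dots> \<le> ennreal (s * measure M (f -` C i))"
        using st by (subst c[symmetric]) (auto intro!: nn_integral_mono simp: C_def indicator_def)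
      finally have 2: "measure M (Y (a i)) \<le> s * measure M (f -` C i)"
        using st by (simp add: ennreal_le_iff)
      have sub: "Y (a i) \<subseteq> Y (a (Suc i))"
        using raSuc[of i] by (auto simp: Y_def intro: order_trans)
      have "X i = Y (a (Suc i)) - Y (a i)"
        by (auto simp: X_def Y_def)
      then have "measure M (X i) = measure M (Y (a (Suc i))) - measure M (Y (a i))"
        using finite_measure_Diff[OF Y Y sub] by simp
      then show ?thesis using 1 2 by (simp add: algebra_simps)
    qed
    have "measure M (f -` D) = (\<Sum>i\<le>Suc n. measure M (f -` C i))"
      unfolding Ccover vimage_UN
    proof (rule finite_measure_finite_Union)
      show "disjoint_family_on (\<lambda>i. f -` C i) {..Suc n}"
        unfolding disjoint_family_on_def using Cdisj by (metis vimage_Int vimage_empty linorder_neqE_nat Int_commute)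
    qed (auto intro: fD)
    then have "(t - s) * measure M (f -` D) = (\<Sum>i\<le>Suc n. (t - s) * measure M (f -` C i))"
      by (simp only: sum_distrib_left)
    also have "\<dots> \<le> (\<Sum>i\<le>Suc n. measure M (X i))"
      by (intro sum_mono Xbig)
    also have "\<dots> = measure M (\<Union>i\<in>{..Suc n}. X i)"
    proof (rule finite_measure_finite_Union[symmetric])
      have "X i \<inter> X j \<subseteq> f -` (C i \<inter> C j)" for i j by (auto simp: X_def)
      then show "disjoint_family_on X {..Suc n}"
        unfolding disjoint_family_on_def using Cdisj
        by (metis vimage_empty linorder_neqE_nat Int_commute subset_empty)
    qed auto
    also have "\<dots> \<le> measure M (V n)"
      using XV by (intro finite_measure_mono) auto
    finally show ?thesis .
  qed
  \<comment> \<open>Two points of one fibre that lie in every \<open>V n\<close> both sit at the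
    jump of this fibre, hence coincide.\<close>
  have "inj_on f (\<Inter>n. V n)"
  proof (rule inj_onI)
    fix x x' assume x: "x \<in> (\<Inter>n. V n)" "x' \<in> (\<Inter>n. V n)" "f x = f x'"
    have *: "ennreal t \<le> h q (f z)" if z: "z \<in> (\<Inter>n. V n)" "\<phi> z < of_rat q" for z q
    proof -
      obtain n where "1 / Suc n < of_rat q - \<phi> z" using z(2) by (metis diff_gt_0_iff_gt nat_approx_posE)
      then have "\<phi> z + 1 / Suc n < of_rat q" by linarith
      then show ?thesis using z(1) by (auto simp: V_def)
    qed
    have **: "h q (f z) < ennreal s" if z: "z \<in> (\<Inter>n. V n)" "of_rat q < \<phi> z" for z q
    proof -
      obtain n where "1 / Suc n < \<phi> z - of_rat q" using z(2) by (metis diff_gt_0_iff_gt nat_approx_posE)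
      then have "of_rat q < \<phi> z - 1 / Suc n" by linarith
      then show ?thesis using z(1) by (auto simp: V_def)
    qed
    have "\<not> \<phi> z < \<phi> z'" if z: "z \<in> (\<Inter>n. V n)" "z' \<in> (\<Inter>n. V n)" "f z = f z'" for z z'
    proof
      assume "\<phi> z < \<phi> z'"
      then obtain q where "\<phi> z < of_rat q" "of_rat q < \<phi> z'" using of_rat_dense by blast
      then have "ennreal t < ennreal s" using *[OF z(1)] **[OF z(2)] z(3) by (metis le_less_trans)
      then show False using st by (simp add: ennreal_less_iff)
    qed
    then have "\<phi> x = \<phi> x'" using x by (metis linorder_less_linear)
    then show "x = x'" using \<phi> by (simp add: inj_eq)
  qed
  then have "measure M (\<Inter>n. V n) = 0"
    using inj[of "\<Inter>n. V n"] by (simp add: measure_def sets.countable_INT)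
  moreover have "(\<lambda>n. measure M (V n)) \<longlonglongrightarrow> measure M (\<Inter>n. V n)"
    by (rule finite_Lim_measure_decseq) (use dec in auto)
  ultimately have "(t - s) * measure M (f -` D) \<le> 0"
    using big by (metis LIMSEQ_le_const)
  then have "measure M (f -` D) = 0"
    using st measure_nonneg[of M "f -` D"] by (simp add: mult_le_0_iff)
  then show ?thesis by (simp add: emeasure_eq_measure)
qed

text \<open>\<open>u\<close> is the \<open>c\<close>-quantile of the distribution function \<open>h _ y\<close>, which is given at rational points
  only. Unlike an infimum, this formula makes sense without monotonicity and is visibly Borel.\<close>

definition cdf_quantile :: "(rat \<Rightarrow> 'b \<Rightarrow> ennreal) \<Rightarrow> 'b \<Rightarrow> real \<Rightarrow> real \<Rightarrow> bool" where
  "cdf_quantile h y c u \<longleftrightarrow>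
     (\<forall>q. (u < of_rat q \<longrightarrow> ennreal c \<le> h q y) \<and> (of_rat q < u \<longrightarrow> h q y < ennreal c))"

lemma cdf_quantile_unique:
  assumes "cdf_quantile h y c u" "cdf_quantile h y c v"
  shows "u = v"
proof -
  have "\<not> u < v" if "cdf_quantile h y c u" "cdf_quantile h y c v" for u v
  proof
    assume "u < v"
    then obtain q where "u < of_rat q" "of_rat q < v" using of_rat_dense by blast
    then have "ennreal c \<le> h q y" "h q y < ennreal c" using that by (auto simp: cdf_quantile_def)
    then show False by simp
  qed
  then show ?thesis using assms by (metis linorder_less_linear)
qed

text \<open>The quantile is the infimum of the rationals at which \<open>h\<close> reaches
  \<open>c\<close>; this set contains 1 and is bounded below by 0.\<close>

lemma cdf_quantile_exists:
  assumes mono: "\<And>p q. p \<le> q \<Longrightarrow> h p y \<le> h q y"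
    and neg: "\<And>q. q < 0 \<Longrightarrow> h q y = 0" and one: "1 \<le> h 1 y" and c: "0 < c" "c < 1"
  shows "\<exists>u. cdf_quantile h y c u"
proof -
  define X where "X = {q. ennreal c \<le> h q y}"
  have "ennreal c \<le> 1" using c by (simp add: ennreal_le_1)
  also note one
  finally have X1: "1 \<in> X" by (simp add: X_def)
  have X0: "0 \<le> q" if "q \<in> X" for q
  proof (rule ccontr)
    assume "\<not> 0 \<le> q"
    then have "h q y = 0" by (intro neg) simp
    then show False using that c by (simp add: X_def)
  qed
  have bdd: "bdd_below (real_of_rat ` X)"
    using X0 by (auto intro!: bdd_belowI[of _ 0])
  define u where "u = Inf (real_of_rat ` X)"
  have "ennreal c \<le> h q y" if "u < of_rat q" for q
  proof -
    have "X \<noteq> {}" using X1 by blast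
    then obtain p where p: "p \<in> X" "real_of_rat p < of_rat q"
      using \<open>u < of_rat q\<close> bdd cInf_less_iff[of "real_of_rat ` X" "of_rat q"] by (auto simp: u_def)
    then have "h p y \<le> h q y" by (intro mono) (auto simp: of_rat_less)
    then show ?thesis using p by (auto simp: X_def)
  qed
  moreover have "h q y < ennreal c" if "of_rat q < u" for q
  proof -
    have "q \<notin> X" using that bdd cInf_lower[of "of_rat q" "real_of_rat ` X"] by (auto simp: u_def)
    then show ?thesis by (auto simp: X_def)
  qed
  ultimately have "cdf_quantile h y c u" by (auto simp: cdf_quantile_def)
  then show ?thesis ..
qed

text \<open>In almost every fibre the \<open>c\<close>-quantile is the height of an actual point,
  since the conditional distribution lives on the compact set \<open>A\<close>, and distinct levels
  \<open>c\<close> have distinct quantiles, since there are no jumps. So the interval (0,1) embeds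
  into the fibre.\<close>

lemma fibre_embedding:
  fixes f :: "'a::t2_space \<Rightarrow> 'b::{t2_space,second_countable_topology}" and \<phi> :: "'a \<Rightarrow> real"
  assumes M: "finite_measure M" "space M = UNIV" and f [measurable]: "f \<in> M \<rightarrow>\<^sub>M borel"
    and \<phi>m [measurable]: "\<phi> \<in> borel_measurable M"
    and A: "compact A" "continuous_on A f" "continuous_on A \<phi>" "AE x in M. x \<in> A"
    and \<phi>: "inj \<phi>" "\<And>x. 0 \<le> \<phi> x" "\<And>x. \<phi> x < 1"
    and inj: "\<And>W. W \<in> sets M \<Longrightarrow> inj_on f W \<Longrightarrow> emeasure M W = 0"
  obtains h N where "\<And>q. h q \<in> borel_measurable borel" "N \<in> null_sets (distr M borel f)"
    "\<And>y c. y \<notin> N \<Longrightarrow> 0 < c \<Longrightarrow> c < 1 \<Longrightarrow> \<exists>x\<in>A. f x = y \<and> cdf_quantile h y c (\<phi> x)"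
    "\<And>y c c' u. y \<notin> N \<Longrightarrow> 0 < c \<Longrightarrow> 0 < c' \<Longrightarrow> c < 1 \<Longrightarrow> c' < 1 \<Longrightarrow>
        cdf_quantile h y c u \<Longrightarrow> cdf_quantile h y c' u \<Longrightarrow> c = c'"
proof -
  interpret finite_measure M by fact
  let ?N = "distr M borel f"
  interpret N: finite_measure ?N by (rule finite_measure_distr) simp
  obtain h :: "rat \<Rightarrow> 'b \<Rightarrow> ennreal" where h [measurable]: "\<And>q. h q \<in> borel_measurable borel"
    and "\<And>q D. D \<in> sets borel \<Longrightarrow> (\<integral>\<^sup>+y\<in>D. h q y \<partial>?N)
        = emeasure M {x\<in>space M. f x \<in> D \<and> \<phi> x \<le> of_rat q}"
    using conditional_cdf_exists[OF M(1) f \<phi>m] by blast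
  then have hint: "\<And>q D. D \<in> sets borel \<Longrightarrow> (\<integral>\<^sup>+y\<in>D. h q y \<partial>?N) = emeasure M {x. f x \<in> D \<and> \<phi> x \<le> of_rat q}"
    by (simp add: M)
  have meas: "{x. f x \<in> D \<and> \<phi> x \<le> of_rat q} \<in> sets M" if [measurable]: "D \<in> sets borel" for D q
  proof -
    have "{x\<in>space M. f x \<in> D \<and> \<phi> x \<le> of_rat q} \<in> sets M" by measurable
    then show ?thesis by (simp add: M)
  qed
  have mono: "AE y in ?N. \<forall>p q. p \<le> q \<longrightarrow> h p y \<le> h q y"
  proof -
    have "AE y in ?N. p \<le> q \<longrightarrow> h p y \<le> h q y" for p q
    proof (cases "p \<le> q")
      case True
      have "AE y in ?N. y \<in> UNIV \<longrightarrow> h p y \<le> h q y"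
      proof (rule AE_le_of_nn_integral_le[OF N.finite_measure_axioms])
        fix D assume "D \<in> sets ?N" "D \<subseteq> UNIV"
        then have "D \<in> sets borel" by simp
        moreover have "{x. f x \<in> D \<and> \<phi> x \<le> of_rat p} \<subseteq> {x. f x \<in> D \<and> \<phi> x \<le> of_rat q}"
          using True by (auto simp: of_rat_less_eq intro: order_trans)
        ultimately show "(\<integral>\<^sup>+y\<in>D. h p y \<partial>?N) \<le> (\<integral>\<^sup>+y\<in>D. h q y \<partial>?N)"
          by (simp add: hint emeasure_mono meas)
      qed auto
      then show ?thesis by simp
    qed simp
    then show ?thesis by (simp add: AE_all_countable)
  qed
  have neg: "AE y in ?N. \<forall>q<0. h q y = 0"
  proof -
    have "AE y in ?N. q < 0 \<longrightarrow> h q y = 0" for q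
    proof (cases "q < 0")
      case True
      have "\<not> \<phi> x \<le> of_rat q" for x
        using True \<phi>(2)[of x] by (simp add: not_le) (metis le_less_trans less_le_trans of_rat_less_0_iff)
      then have "(\<integral>\<^sup>+y. h q y \<partial>?N) = 0"
        using hint[of UNIV q] by simp
      then have "AE y in ?N. h q y = 0"
        by (subst (asm) nn_integral_0_iff_AE) auto
      then show ?thesis by simp
    qed simp
    then show ?thesis by (simp add: AE_all_countable)
  qed
  have one: "AE y in ?N. 1 \<le> h 1 y"
  proof -
    have "AE y in ?N. y \<in> UNIV \<longrightarrow> 1 \<le> h 1 y"
    proof (rule AE_le_of_nn_integral_le[OF N.finite_measure_axioms])
      fix D assume "D \<in> sets ?N" "D \<subseteq> UNIV"
      then have D: "D \<in> sets borel" by simp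
      have "{x. f x \<in> D \<and> \<phi> x \<le> of_rat 1} = f -` D" using \<phi>(3) by (auto intro: less_imp_le)
      then show "(\<integral>\<^sup>+y\<in>D. 1 \<partial>?N) \<le> (\<integral>\<^sup>+y\<in>D. h 1 y \<partial>?N)"
        using D by (simp add: hint emeasure_distr M)
    qed auto
    then show ?thesis by simp
  qed
  \<comment> \<open>\<open>J p r\<close> holds the \<open>y\<close> whose fibre has a point of
    \<open>A\<close> with height between \<open>p\<close> and \<open>r\<close>. Off it the
    conditional distribution function gains nothing from \<open>p\<close> to
    \<open>r\<close>.\<close>
  define J where "J p r = f ` (A \<inter> \<phi> -` {real_of_rat p..real_of_rat r})" for p r
  have cJ: "compact (J p r)" for p r
  proof -
    have "closed (A \<inter> \<phi> -` {real_of_rat p..real_of_rat r})"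
      using A compact_imp_closed by (intro continuous_closed_preimage) auto
    then have "compact (A \<inter> \<phi> -` {real_of_rat p..real_of_rat r})"
      using A(1) by (metis Int_absorb1 compact_Int_closed inf_le1 Int_commute)
    then show ?thesis
      unfolding J_def using A(2) by (intro compact_continuous_image) (auto intro: continuous_on_subset)
  qed
  have [measurable]: "J p r \<in> sets borel" for p r using cJ by (rule borel_compact)
  have flat: "AE y in ?N. \<forall>p r. y \<notin> J p r \<longrightarrow> h r y \<le> h p y"
  proof -
    have "AE y in ?N. y \<in> - J p r \<longrightarrow> h r y \<le> h p y" for p r
    proof (rule AE_le_of_nn_integral_le[OF N.finite_measure_axioms])
      fix D assume D: "D \<in> sets ?N" "D \<subseteq> - J p r"
      have "emeasure M {x. f x \<in> D \<and> \<phi> x \<le> of_rat r} \<le> emeasure M {x. f x \<in> D \<and> \<phi> x \<le> of_rat p}"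
      proof (rule emeasure_mono_AE)
        show "AE x in M. x \<in> {x. f x \<in> D \<and> \<phi> x \<le> of_rat r} \<longrightarrow> x \<in> {x. f x \<in> D \<and> \<phi> x \<le> of_rat p}"
          using A(4)
        proof eventually_elim
          case (elim x)
          have "f x \<notin> D" if "of_rat p < \<phi> x" "\<phi> x \<le> of_rat r"
            using that elim D(2) by (force simp: J_def)
          then show ?case by force
        qed
      qed (use D in \<open>simp add: meas\<close>)
      then show "(\<integral>\<^sup>+y\<in>D. h r y \<partial>?N) \<le> (\<integral>\<^sup>+y\<in>D. h p y \<partial>?N)"
        using D by (simp add: hint)
    qed auto
    then show ?thesis by (simp add: AE_all_countable)
  qed
  obtain N0 where N0: "N0 \<in> null_sets ?N"
    and N0': "\<And>y p q. y \<notin> N0 \<Longrightarrow> p \<le> q \<Longrightarrow> h p y \<le> h q y" "\<And>y q. y \<notin> N0 \<Longrightarrow> q < 0 \<Longrightarrow> h q y = 0"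
      "\<And>y. y \<notin> N0 \<Longrightarrow> 1 \<le> h 1 y" "\<And>y p r. y \<notin> N0 \<Longrightarrow> y \<notin> J p r \<Longrightarrow> h r y \<le> h p y"
  proof -
    have "AE y in ?N. (\<forall>p q. p \<le> q \<longrightarrow> h p y \<le> h q y) \<and> (\<forall>q<0. h q y = 0) \<and> 1 \<le> h 1 y \<and>
      (\<forall>p r. y \<notin> J p r \<longrightarrow> h r y \<le> h p y)"
      using mono neg one flat by eventually_elim blast
    then obtain N0 where "N0 \<in> null_sets ?N" "{y\<in>space ?N. \<not> ((\<forall>p q. p \<le> q \<longrightarrow> h p y \<le> h q y) \<and>
        (\<forall>q<0. h q y = 0) \<and> 1 \<le> h 1 y \<and> (\<forall>p r. y \<notin> J p r \<longrightarrow> h r y \<le> h p y))} \<subseteq> N0"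
      unfolding eventually_ae_filter by blast
    then have "y \<notin> N0 \<Longrightarrow> (\<forall>p q. p \<le> q \<longrightarrow> h p y \<le> h q y) \<and>
        (\<forall>q<0. h q y = 0) \<and> 1 \<le> h 1 y \<and> (\<forall>p r. y \<notin> J p r \<longrightarrow> h r y \<le> h p y)" for y
      unfolding space_distr space_borel by blast
    then show thesis using \<open>N0 \<in> null_sets ?N\<close> by (intro that[of N0]) blast+
  qed
  have [measurable]: "N0 \<in> sets borel" using N0 by auto
  \<comment> \<open>The fibres whose distribution function skips all values from \<open>s\<close> up
    to \<open>t\<close>.\<close>
  define D where "D s t = {y. y \<notin> N0 \<and> (\<forall>q. h q y < ennreal (of_rat s) \<or> ennreal (of_rat t) \<le> h q y)}" for s t
  have Dm [measurable]: "D s t \<in> sets borel" for s t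
  proof -
    have "{y\<in>space borel. y \<notin> N0 \<and> (\<forall>q. h q y < ennreal (of_rat s) \<or> ennreal (of_rat t) \<le> h q y)} \<in> sets borel"
      by measurable
    then show ?thesis by (simp add: D_def)
  qed
  have D0: "D s t \<in> null_sets ?N" if "0 < s" "s < t" "t < 1" for s t
  proof -
    have "emeasure M (f -` D s t) = 0"
    proof (rule conditional_cdf_no_jump[OF M f \<phi>m h hint Dm N0'(1) N0'(2) N0'(3)])
      show "0 < real_of_rat s" "real_of_rat s < of_rat t" "real_of_rat t \<le> 1"
        using that by (auto simp: of_rat_less)
      fix y q assume "y \<in> D s t"
      then show "h q y < ennreal (of_rat s) \<or> ennreal (of_rat t) \<le> h q y" by (auto simp: D_def)
    qed (use \<phi> inj in \<open>auto simp: D_def\<close>)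
    then show ?thesis by (simp add: null_sets_def emeasure_distr M)
  qed
  let ?X = "N0 \<union> (\<Union>s. \<Union>t. if 0 < s \<and> s < t \<and> t < 1 then D s t else {})"
  show thesis
  proof (rule that[of h ?X])
    show "h q \<in> borel_measurable borel" for q by simp
    show "?X \<in> null_sets ?N"
      using N0 D0 by (intro null_sets.Un null_sets_UN) auto
  next
    fix y and c :: real assume y: "y \<notin> ?X" and c: "0 < c" "c < 1"
    then have y0: "y \<notin> N0" by blast
    obtain u where u: "cdf_quantile h y c u"
      using cdf_quantile_exists[of h y c] N0'(1-3)[OF y0] c by blast
    let ?K = "\<phi> ` (A \<inter> f -` {y})"
    have "closed (A \<inter> f -` {y})"
      using A compact_imp_closed by (intro continuous_closed_preimage) auto
    then have "compact (A \<inter> f -` {y})"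
      using A(1) by (metis Int_absorb1 compact_Int_closed inf_le1 Int_commute)
    then have "compact ?K"
      using A(3) by (intro compact_continuous_image) (auto intro: continuous_on_subset)
    then have "closed ?K" by (rule compact_imp_closed)
    \<comment> \<open>Just below \<open>u\<close> the function is under \<open>c\<close> and just
      above \<open>u\<close> it is at least \<open>c\<close>; it grows in between, so the fibre has
      a point at nearly the height \<open>u\<close>. Closedness of \<open>?K\<close> then gives the
      height \<open>u\<close> itself.\<close>
    moreover have "\<exists>v\<in>?K. dist v u < e" if "0 < e" for e
    proof -
      obtain p where p: "u - e < of_rat p" "of_rat p < u" using of_rat_dense[of "u - e" u] \<open>0 < e\<close> by auto
      obtain r where r: "u < of_rat r" "of_rat r < u + e" using of_rat_dense[of u "u + e"] \<open>0 < e\<close> by auto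
      have "h p y < ennreal c" "ennreal c \<le> h r y" using u p r by (auto simp: cdf_quantile_def)
      then have "y \<in> J p r" using N0'(4)[OF y0, of p r] by (meson le_less_trans not_le)
      then obtain x where "x \<in> A" "f x = y" "of_rat p \<le> \<phi> x" "\<phi> x \<le> of_rat r" by (auto simp: J_def)
      then have "\<phi> x \<in> ?K" "dist (\<phi> x) u < e" using p r by (auto simp: dist_real_def)
      then show ?thesis ..
    qed
    ultimately have "u \<in> ?K" by (metis closure_approachable closure_closed)
    then show "\<exists>x\<in>A. f x = y \<and> cdf_quantile h y c (\<phi> x)" using u by auto
  next
    \<comment> \<open>A failure of injectivity is a jump, except that \<open>h\<close> may take an intermediate value at the
      jump point itself; two disjoint gaps below rule this out.\<close>
    have at: "\<exists>q. of_rat q = u \<and> ennreal (of_rat s) \<le> h q y \<and> h q y < ennreal (of_rat t)"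
      if y: "y \<notin> ?X" and c: "0 < c" "c' < 1" "cdf_quantile h y c u" "cdf_quantile h y c' u"
        and s: "c < real_of_rat s" and st: "real_of_rat s < real_of_rat t" and t: "real_of_rat t < c'"
      for y c c' u s t
    proof -
      have "0 < real_of_rat s" "real_of_rat t < 1"
        using s t c by linarith+
      then have "0 < s" "s < t" "t < 1"
        using st by (simp_all only: zero_less_of_rat_iff of_rat_less_1_iff of_rat_less)
      then have "y \<notin> D s t" using y by (auto split: if_splits)
      then obtain q where q: "ennreal (of_rat s) \<le> h q y" "h q y < ennreal (of_rat t)"
        using y by (auto simp: D_def not_less not_le)
      have "\<not> real_of_rat q < u"
      proof
        assume "real_of_rat q < u"
        then have "h q y < ennreal c" using c by (auto simp: cdf_quantile_def)
        moreover have "ennreal c \<le> ennreal (of_rat s)" using s by (intro ennreal_leI) simp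
        ultimately show False using q(1) by (meson leD le_less_trans less_le_trans)
      qed
      moreover have "\<not> u < real_of_rat q"
      proof
        assume "u < real_of_rat q"
        then have "ennreal c' \<le> h q y" using c by (auto simp: cdf_quantile_def)
        moreover have "ennreal (of_rat t) \<le> ennreal c'" using t by (intro ennreal_leI) simp
        ultimately show False using q(2) by (meson leD order_trans)
      qed
      ultimately show ?thesis using q by (intro exI[of _ q]) linarith
    qed
    have no: "\<not> c < c'" if y: "y \<notin> ?X" and c: "0 < c" "c' < 1" "cdf_quantile h y c u" "cdf_quantile h y c' u" for y c c' u
    proof
      assume "c < c'"
      then obtain s1 where s1: "c < real_of_rat s1" "real_of_rat s1 < c'" using of_rat_dense by blast
      then obtain t1 where t1: "real_of_rat s1 < of_rat t1" "of_rat t1 < c'" using of_rat_dense by blast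
      then obtain t2 where t2: "real_of_rat t1 < of_rat t2" "of_rat t2 < c'" using of_rat_dense by blast
      obtain q where q: "real_of_rat q = u" "h q y < ennreal (of_rat t1)"
        using at[OF y c s1(1) t1] by blast
      obtain q' where "real_of_rat q' = u" "ennreal (of_rat t1) \<le> h q' y"
        using at[OF y c _ t2] s1 t1 by fastforce
      then have "ennreal (of_rat t1) \<le> h q y" using q by (metis of_rat_eq_iff)
      then show False using q(2) by simp
    qed
    fix y c c' u assume "y \<notin> ?X" "0 < c" "0 < c'" "c < 1" "c' < 1" "cdf_quantile h y c u" "cdf_quantile h y c' u"
    then show "c = c'" using no[of y c c' u] no[of y c' c u] by (metis linorder_less_linear)
  qed
qed

section \<open>Null sets have null neighbourhoods\<close>

context pmp_borel_graph
begin

lemma null_if_many_disjoint_copies: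
  fixes L :: "nat \<Rightarrow> 'a set"
  assumes L: "\<And>i. L i \<in> sets M" "disjoint_family L" and t: "0 < t" "\<And>i. t \<le> measure M (L i)"
  shows False
proof -
  obtain n where n: "1 / t < real n" using reals_Archimedean2 by blast
  have "real n * t = (\<Sum>i<n. t)" by simp
  also have "\<dots> \<le> (\<Sum>i<n. measure M (L i))" by (intro sum_mono t)
  also have "\<dots> = measure M (\<Union>i\<in>{..<n}. L i)"
    using L by (intro finite_measure_finite_Union[symmetric])
      (auto simp: disjoint_family_on_def)
  also have "\<dots> \<le> 1" by simp
  finally have "real n * t \<le> 1" .
  then show False using n t by (simp add: field_simps)
qed

text \<open>If a set of positive measure mapped along edges into a null set by \<open>f\<close>, then \<open>f\<close> would
  have atomless fibres, and the fibrewise quantile function would give infinitely many disjoint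
  copies of this set, all in the same components.\<close>

lemma outer_measure_graph_into_null:
  assumes T: "T \<in> sets borel" "\<And>x y. (x, y) \<in> T \<Longrightarrow> E x y" "inj_on fst T" "snd ` T \<subseteq> N" "N \<in> null_sets M"
  shows "outer_measure_of M (fst ` T) = 0"
proof (rule ccontr)
  assume "outer_measure_of M (fst ` T) \<noteq> 0"
  then obtain t where t: "0 < t" "t < outer_measure_of M (fst ` T)"
    using dense[of 0 "outer_measure_of M (fst ` T)"] by (auto simp: zero_less_iff_neq_zero)
  obtain \<phi> :: "'a \<Rightarrow> real" where \<phi>m [measurable]: "\<phi> \<in> borel_measurable borel" and \<phi>: "inj \<phi>"
    "\<And>x. 0 \<le> \<phi> x" "\<And>x. \<phi> x < 1"
    using injective_real_embedding by blast
  have [measurable]: "T \<in> sets (borel \<Otimes>\<^sub>M borel)"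
    using T(1) by (metis borel_prod)
  \<comment> \<open>Adjoining the value of \<phi> to each pair lets a single compact set
    \<open>K\<close> make \<open>f\<close> and \<phi> continuous on its projection together, in the
    manner of Lusin's theorem.\<close>
  define T' where "T' = {p :: 'a \<times> 'a \<times> real. (fst p, fst (snd p)) \<in> T \<and> snd (snd p) = \<phi> (fst p)}"
  have "T' = {p\<in>space (borel \<Otimes>\<^sub>M (borel \<Otimes>\<^sub>M borel)). (fst p, fst (snd p)) \<in> T \<and> snd (snd p) = \<phi> (fst p)}"
    by (auto simp: T'_def space_pair_measure)
  also have "\<dots> \<in> sets (borel \<Otimes>\<^sub>M (borel \<Otimes>\<^sub>M borel))" by measurable
  finally have T'm: "T' \<in> sets borel" by (metis borel_prod)
  have fT': "fst ` T' = fst ` T" by (force simp: T'_def image_iff)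
  have "continuous_on UNIV (fst :: 'a \<times> 'a \<times> real \<Rightarrow> 'a)" by (intro continuous_intros)
  then obtain K where K: "compact K" "K \<subseteq> T'" "t \<le> emeasure M (fst ` K)"
    using borel_image_capacitable[OF sets_M finite_measure_M _ T'm, of fst t] t(2) fT' by metis
  define A where "A = fst ` K"
  have cA: "compact A" unfolding A_def by (intro compact_continuous_image K continuous_intros)
  then have [measurable]: "A \<in> sets borel" by (rule borel_compact)
  have injK: "inj_on fst K"
  proof (rule inj_onI)
    fix p p' assume p: "p \<in> K" "p' \<in> K" "fst p = fst p'"
    then have "(fst p, fst (snd p)) = (fst p', fst (snd p'))"
      using K(2) by (intro inj_onD[OF T(3)]) (auto simp: T'_def)
    moreover have "p \<in> T'" "p' \<in> T'" using p K(2) by blast+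
    then have "snd (snd p) = snd (snd p')" using p(3) by (simp add: T'_def)
    ultimately show "p = p'" by (simp add: prod_eq_iff)
  qed
  define f where "f x = (if x \<in> A then fst (graph_fun K x) else undefined)" for x
  have gK: "(x, f x) \<in> T" "snd (graph_fun K x) = \<phi> x" if "x \<in> A" for x
  proof -
    have "(x, graph_fun K x) \<in> K" using that graph_fun_iff[OF injK] unfolding A_def by blast
    then have "(x, graph_fun K x) \<in> T'" using K(2) by blast
    then show "(x, f x) \<in> T" "snd (graph_fun K x) = \<phi> x" using that by (auto simp: T'_def f_def)
  qed
  have contK: "continuous_on A (graph_fun K)"
    unfolding A_def by (intro continuous_on_graph_fun K injK)
  have cf: "continuous_on A f"
  proof -
    have "continuous_on A (\<lambda>x. fst (graph_fun K x))" by (intro continuous_intros contK)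
    then show ?thesis by (rule continuous_on_eq) (simp add: f_def)
  qed
  have c\<phi>: "continuous_on A \<phi>"
  proof -
    have "continuous_on A (\<lambda>x. snd (graph_fun K x))" by (intro continuous_intros contK)
    then show ?thesis by (rule continuous_on_eq) (simp add: gK)
  qed
  have fm [measurable]: "f \<in> borel_measurable borel"
  proof -
    have "(\<lambda>x. if x \<in> A then f x else undefined) \<in> borel_measurable borel"
      by (rule borel_measurable_continuous_on_if) (auto intro: cf)
    moreover have "(\<lambda>x. if x \<in> A then f x else undefined) = f" by (auto simp: f_def)
    ultimately show ?thesis by simp
  qed
  define M' where "M' = density M (indicator A)"
  have M': "space M' = UNIV" "sets M' = sets borel" by (simp_all add: M'_def space_M sets_M)
  have em: "emeasure M' W = emeasure M (A \<inter> W)" if "W \<in> sets borel" for W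
    unfolding M'_def using that by (intro emeasure_restricted) (auto simp: sets_M)
  have fin: "finite_measure M'"
    by (rule finite_measureI) (simp add: M' em)
  have M'm: "measurable M' L = measurable borel L" for L :: "'c measure"
    by (intro measurable_cong_sets) (simp_all add: M')
  have edge: "E x (f x)" "f x \<in> N" if "x \<in> A" for x
    using gK(1)[OF that] T by auto
  \<comment> \<open>Where \<open>f\<close> is injective it is a partial bijection along edges into
    the null set \<open>N\<close>, so pmp forces measure 0.\<close>
  have inj: "emeasure M' W = 0" if W: "W \<in> sets M'" "inj_on f W" for W
  proof -
    have [measurable]: "W \<in> sets borel" using W(1) by (simp add: M')
    \<comment> \<open>Equality of points is tested through the injection \<phi>, which makes it a
      measurable condition.\<close>
    define S where "S = {p. fst p \<in> A \<inter> W \<and> \<phi> (snd p) = \<phi> (f (fst p))}"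
    have "S = {p\<in>space (borel \<Otimes>\<^sub>M borel). fst p \<in> A \<inter> W \<and> \<phi> (snd p) = \<phi> (f (fst p))}"
      by (auto simp: S_def space_pair_measure)
    also have "\<dots> \<in> sets (borel \<Otimes>\<^sub>M borel)" by measurable
    finally have Sm: "S \<in> sets borel" by (metis borel_prod)
    have S: "(x, y) \<in> S \<longleftrightarrow> x \<in> A \<inter> W \<and> y = f x" for x y
      using \<phi>(1) by (auto simp: S_def inj_eq)
    have "fst ` S = A \<inter> W"
    proof (intro equalityI subsetI)
      fix x assume "x \<in> fst ` S"
      then obtain y where "(x, y) \<in> S" by auto
      then show "x \<in> A \<inter> W" unfolding S by blast
    next
      fix x assume "x \<in> A \<inter> W"
      then have "(x, f x) \<in> S" unfolding S by blast
      then show "x \<in> fst ` S" by (metis fst_conv imageI)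
    qed
    moreover have "outer_measure_of M (fst ` S) = outer_measure_of M (snd ` S)"
    proof (rule outer_measure_fst_eq_snd[OF Sm])
      show "inj_on fst S" "inj_on snd S" using W(2) by (auto simp: inj_on_def S)
      show "E\<^sup>*\<^sup>* x y" if "(x, y) \<in> S" for x y
        using that edge by (auto simp: S)
    qed
    moreover have "snd ` S \<subseteq> N" using edge by (auto simp: S)
    then have "outer_measure_of M (snd ` S) = 0"
      using T(5) by (subst outer_measure_of_null_iff) (auto simp: space_M)
    ultimately show ?thesis by (simp add: em sets_M)
  qed
  have AE_A: "AE x in M'. x \<in> A"
  proof (rule AE_I[of _ _ "- A"])
    show "emeasure M' (- A) = 0" by (simp add: em)
  qed (auto simp: M')
  obtain h N' where h [measurable]: "\<And>q. h q \<in> borel_measurable borel" and N': "N' \<in> null_sets (distr M' borel f)"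
    and ex: "\<And>y c. y \<notin> N' \<Longrightarrow> 0 < c \<Longrightarrow> c < 1 \<Longrightarrow> \<exists>x\<in>A. f x = y \<and> cdf_quantile h y c (\<phi> x)"
    and un: "\<And>y c c' u. y \<notin> N' \<Longrightarrow> 0 < c \<Longrightarrow> 0 < c' \<Longrightarrow> c < 1 \<Longrightarrow> c' < 1 \<Longrightarrow>
        cdf_quantile h y c u \<Longrightarrow> cdf_quantile h y c' u \<Longrightarrow> c = c'"
    using fibre_embedding[OF fin M'(1) _ _ cA cf c\<phi> AE_A \<phi> inj] fm \<phi>m unfolding M'm by metis
  have [measurable]: "N' \<in> sets borel" using N' by auto
  define B where "B = A \<inter> f -` (- N')"
  have "f -` X \<in> sets borel" if "X \<in> sets borel" for X
    using measurable_sets[OF fm that] by simp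
  then have Bm [measurable]: "B \<in> sets borel" and fN': "f -` N' \<in> sets borel"
    by (auto simp: B_def)
  have MB: "t \<le> emeasure M B"
  proof -
    have "emeasure M (A \<inter> f -` N') = 0"
      using N' em[OF fN'] by (auto simp: null_sets_def emeasure_distr M'm M')
    then have "emeasure M A \<le> emeasure M B + 0"
      using emeasure_subadditive[of B M "A \<inter> f -` N'"] Bm fN' by (simp add: sets_M B_def Int_Un_distrib[symmetric] flip: vimage_Un)
    then show ?thesis using K(3) by (simp add: A_def)
  qed
  \<comment> \<open>For each \<open>i\<close> this maps [0,1) affinely onto [1/(i+3), 1/(i+2)).
    These intervals are disjoint and lie inside (0,1), so the level determines both \<open>i\<close>
    and \<open>r\<close>.\<close>
  define \<psi> where "\<psi> i r = 1 / (real i + 3) + r * (1 / (real i + 2) - 1 / (real i + 3))" for i r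
  have d: "0 < 1 / (real i + 2) - 1 / (real i + 3)" for i
  proof -
    have "1 / (real i + 3) < 1 / (real i + 2)" by (intro divide_strict_left_mono) auto
    then show ?thesis by simp
  qed
  have \<psi>_bounds: "1 / (real i + 3) \<le> \<psi> i r" "\<psi> i r < 1 / (real i + 2)" if "0 \<le> r" "r < 1" for i r
  proof -
    show "1 / (real i + 3) \<le> \<psi> i r" using that d[of i] by (simp add: \<psi>_def)
    have "r * (1 / (real i + 2) - 1 / (real i + 3)) < 1 * (1 / (real i + 2) - 1 / (real i + 3))"
      using that d[of i] by (intro mult_strict_right_mono)
    then show "\<psi> i r < 1 / (real i + 2)" by (simp add: \<psi>_def)
  qed
  have \<psi>01: "0 < \<psi> i (\<phi> x)" "\<psi> i (\<phi> x) < 1" for i x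
  proof -
    have "0 < 1 / (real i + 3)" "1 / (real i + 2) < 1" by simp_all
    then show "0 < \<psi> i (\<phi> x)" "\<psi> i (\<phi> x) < 1"
      using \<psi>_bounds[OF \<phi>(2,3), of i x] by linarith+
  qed
  have \<psi>_neq: "\<psi> i (\<phi> x) \<noteq> \<psi> j (\<phi> x')" if "i < j" for i j x x'
  proof -
    have "1 / (real j + 2) \<le> 1 / (real i + 3)" using that by (intro divide_left_mono) auto
    then show ?thesis using \<psi>_bounds[OF \<phi>(2,3), of j x'] \<psi>_bounds[OF \<phi>(2,3), of i x] by linarith
  qed
  have \<psi>_inj: "x = x'" if "\<psi> i (\<phi> x) = \<psi> i (\<phi> x')" for i x x'
  proof -
    have "\<phi> x = \<phi> x'" using that d[of i] by (simp add: \<psi>_def)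
    then show ?thesis using \<phi>(1) by (simp add: inj_eq)
  qed
  \<comment> \<open>\<open>S i\<close> pairs \<open>x\<close> with the point of its own fibre whose
    height is the quantile at level \<open>\<psi> i (\<phi> x)\<close>. This is
    \<open>cdf_quantile\<close> unfolded, with equality in the fibre tested through \<phi>, to make
    measurability visible.\<close>
  define S where "S i = {p. fst p \<in> B \<and> snd p \<in> A \<and> \<phi> (f (fst p)) = \<phi> (f (snd p)) \<and>
     (\<forall>q. (\<phi> (snd p) < of_rat q \<longrightarrow> ennreal (\<psi> i (\<phi> (fst p))) \<le> h q (f (fst p))) \<and>
          (of_rat q < \<phi> (snd p) \<longrightarrow> h q (f (fst p)) < ennreal (\<psi> i (\<phi> (fst p)))))}" for i
  have S: "(x, x') \<in> S i \<longleftrightarrow> x \<in> B \<and> x' \<in> A \<and> f x' = f x \<and> cdf_quantile h (f x) (\<psi> i (\<phi> x)) (\<phi> x')" for x x' i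
    using \<phi>(1) by (auto simp: S_def inj_eq cdf_quantile_def)
  have Sm: "S i \<in> sets borel" for i
  proof -
    have "S i = {p\<in>space (borel \<Otimes>\<^sub>M borel). fst p \<in> B \<and> snd p \<in> A \<and> \<phi> (f (fst p)) = \<phi> (f (snd p)) \<and>
     (\<forall>q. (\<phi> (snd p) < of_rat q \<longrightarrow> ennreal (\<psi> i (\<phi> (fst p))) \<le> h q (f (fst p))) \<and>
          (of_rat q < \<phi> (snd p) \<longrightarrow> h q (f (fst p)) < ennreal (\<psi> i (\<phi> (fst p)))))}"
      by (auto simp: S_def space_pair_measure)
    also have "\<dots> \<in> sets (borel \<Otimes>\<^sub>M borel)" unfolding \<psi>_def by measurable
    finally show ?thesis by (metis borel_prod)
  qed
  have same: "f x \<notin> N'" if "x \<in> B" for x using that by (auto simp: B_def)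
  have outer: "outer_measure_of M (snd ` S i) = emeasure M B" for i
  proof -
    have "\<exists>x'. (x, x') \<in> S i" if "x \<in> B" for x
      using ex[OF same[OF that] \<psi>01] that unfolding S by metis
    then have "B \<subseteq> fst ` S i" by (metis fst_conv imageI subsetI)
    moreover have "fst ` S i \<subseteq> B" using S by auto
    ultimately have "fst ` S i = B" by blast
    moreover have "outer_measure_of M (fst ` S i) = outer_measure_of M (snd ` S i)"
    proof (rule outer_measure_fst_eq_snd[OF Sm])
      show "inj_on fst (S i)"
      proof (rule inj_onI)
        fix p p' assume p: "p \<in> S i" "p' \<in> S i" "fst p = fst p'"
        obtain x z z' where x: "p = (x, z)" "p' = (x, z')" using p(3) by (metis prod.collapse)
        have "\<phi> z = \<phi> z'"
          using p unfolding x S by (blast intro: cdf_quantile_unique)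
        then show "p = p'" using \<phi>(1) x by (simp add: inj_eq)
      qed
      show "inj_on snd (S i)"
      proof (rule inj_onI)
        fix p p' assume p: "p \<in> S i" "p' \<in> S i" "snd p = snd p'"
        obtain x x' z where x: "p = (x, z)" "p' = (x', z)" using p(3) by (metis prod.collapse)
        have "\<psi> i (\<phi> x) = \<psi> i (\<phi> x')"
          using p unfolding x S by (intro un[of "f x" _ _ "\<phi> z"] same \<psi>01) auto
        then show "p = p'" using \<psi>_inj x by blast
      qed
      show "E\<^sup>*\<^sup>* x x'" if "(x, x') \<in> S i" for x x'
      proof -
        \<comment> \<open>The two points share the neighbour \<open>f x\<close>; a path of length
          two is enough for pmp, which covers all pairs in one component.\<close>
        have "E x (f x)" "E (f x) x'"
          using that edge[of x] edge[of x'] by (auto simp: S B_def intro: E_sym)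
        then show ?thesis by (meson r_into_rtranclp rtranclp.rtrancl_into_rtrancl)
      qed
    qed
    ultimately show ?thesis using Bm by (simp add: sets_M)
  qed
  \<comment> \<open>Capacitability requires a bound strictly below the outer measure, and
    \<open>t\<close> may equal it.\<close>
  obtain t' where t': "0 < t'" "t' < t" using dense[OF t(1)] by blast
  have "\<exists>F. compact F \<and> F \<subseteq> S i \<and> t' \<le> emeasure M (snd ` F)" for i
  proof -
    have "continuous_on UNIV (snd :: 'a \<times> 'a \<Rightarrow> 'a)" by (intro continuous_intros)
    moreover have "t' < outer_measure_of M (snd ` S i)" using outer MB t' by (auto intro: less_le_trans)
    ultimately show ?thesis
      using borel_image_capacitable[OF sets_M finite_measure_M _ Sm, of snd t'] by metis
  qed
  then obtain F where F: "\<And>i. compact (F i)" "\<And>i. F i \<subseteq> S i" "\<And>i. t' \<le> emeasure M (snd ` F i)" by metis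
  show False
  proof (rule null_if_many_disjoint_copies)
    have "compact (snd ` F i)" for i by (intro compact_continuous_image F continuous_intros)
    then show "snd ` F i \<in> sets M" for i by (simp add: sets_M borel_compact)
    have "snd ` S i \<inter> snd ` S j = {}" if "i < j" for i j
    proof (rule ccontr)
      assume "snd ` S i \<inter> snd ` S j \<noteq> {}"
      then obtain x x' z where xz: "(x, z) \<in> S i" "(x', z) \<in> S j" by auto
      then have "\<psi> i (\<phi> x) = \<psi> j (\<phi> x')"
        unfolding S by (intro un[of "f x" _ _ "\<phi> z"] same \<psi>01) auto
      then show False using \<psi>_neq[OF that] by blast
    qed
    then have "snd ` F i \<inter> snd ` F j = {}" if "i < j" for i j
      using F(2) that by blast
    then show "disjoint_family (\<lambda>i. snd ` F i)"
      unfolding disjoint_family_on_def by (metis linorder_neqE_nat Int_commute)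
    have "t' < top" using t t' by (meson less_top_ennreal less_trans order_less_le_trans top_greatest)
    then show "0 < enn2real t'" using t' by (simp add: enn2real_positive_iff)
    show "enn2real t' \<le> measure M (snd ` F i)" for i
      unfolding measure_def using F(3) by (intro enn2real_mono) (auto simp: less_top[symmetric])
  qed
qed

text \<open>The edges into \<open>N\<close> split into countably many graphs of functions, each with
  a null domain by \<open>outer_measure_graph_into_null\<close>.\<close>

lemma null_neighbours:
  assumes N: "N \<in> null_sets M"
  obtains N' where "N' \<in> null_sets M" "\<And>x y. x \<notin> N' \<Longrightarrow> E x y \<Longrightarrow> y \<notin> N"
proof -
  obtain T N0 where T: "\<And>n::nat. T n \<in> sets borel" "\<And>n. T n \<subseteq> {(x, y). E x y}" "\<And>n. inj_on fst (T n)"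
    and N0: "N0 \<in> null_sets M" "\<And>x y. x \<notin> N0 \<Longrightarrow> (x, y) \<in> {(x, y). E x y} \<Longrightarrow> \<exists>n. (x, y) \<in> T n"
    using borel_uniformization_ae[OF E_borel] AE_finite_degree by auto
  have Nb: "N \<in> sets borel" using N by (auto simp: sets_M)
  have "\<exists>N'\<in>null_sets M. fst ` (T n \<inter> UNIV \<times> N) \<subseteq> N'" for n
  proof -
    have "UNIV \<times> N \<in> sets (borel \<Otimes>\<^sub>M borel)" using Nb by (intro pair_measureI) auto
    then have "UNIV \<times> N \<in> sets (borel :: ('a \<times> 'a) measure)" by (metis borel_prod)
    then have "T n \<inter> UNIV \<times> N \<in> sets borel" using T(1) by blast
    then have "outer_measure_of M (fst ` (T n \<inter> UNIV \<times> N)) = 0"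
      using T by (intro outer_measure_graph_into_null[OF _ _ _ _ N]) (auto intro: inj_on_subset[OF T(3)[of n]])
    then show ?thesis by (subst (asm) outer_measure_of_null_iff) (auto simp: space_M)
  qed
  then obtain N1 where N1: "\<And>n. N1 n \<in> null_sets M" "\<And>n. fst ` (T n \<inter> UNIV \<times> N) \<subseteq> N1 n" by metis
  show thesis
  proof (rule that[of "N0 \<union> (\<Union>n. N1 n)"])
    show "N0 \<union> (\<Union>n. N1 n) \<in> null_sets M"
      using N0 N1 by (intro null_sets.Un null_sets_UN) auto
    fix x y assume x: "x \<notin> N0 \<union> (\<Union>n. N1 n)" "E x y"
    then obtain n where "(x, y) \<in> T n" using N0(2)[of x y] by auto
    then show "y \<notin> N" using x N1(2)[of n] by force
  qed
qed

text \<open>This is what lets the adjacency operator act on functions modulo null sets.\<close>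

lemma AE_neighbours:
  assumes "AE x in M. P x" shows "AE x in M. \<forall>y. E x y \<longrightarrow> P y"
proof -
  obtain N where N: "N \<in> null_sets M" "\<And>x. x \<notin> N \<Longrightarrow> P x"
    using assms by (auto simp: eventually_ae_filter space_M)
  obtain N' where "N' \<in> null_sets M" "\<And>x y. x \<notin> N' \<Longrightarrow> E x y \<Longrightarrow> y \<notin> N"
    using null_neighbours[OF N(1)] by blast
  then show ?thesis using N(2) by (intro AE_I'[of N']) auto
qed

end

section \<open>The adjacency operator\<close>

context pmp_borel_graph
begin

text \<open>An almost everywhere form of the Feldman-Moore decomposition. Selecting in the second
  coordinate and then in the first makes the pieces injective on both sides; each is then exhausted
  by compact subsets.\<close>

lemma partial_bijection_cover:
  obtains F :: "nat \<Rightarrow> ('a \<times> 'a) set" and N D where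
    "\<And>n. compact (F n)" "\<And>n x y. (x, y) \<in> F n \<Longrightarrow> E x y" "\<And>n. inj_on fst (F n)" "\<And>n. inj_on snd (F n)"
    "N \<in> null_sets M" "\<And>x y. x \<notin> N \<Longrightarrow> E x y \<Longrightarrow> \<exists>n. (x, y) \<in> F n"
    "\<And>x. x \<notin> N \<Longrightarrow> finite {y. E x y}" "\<And>x. x \<notin> N \<Longrightarrow> card {y. E x y} \<le> D"
proof -
  obtain T N0 where T: "\<And>n::nat. T n \<in> sets borel" "\<And>n. T n \<subseteq> {(x, y). E x y}" "\<And>n. inj_on fst (T n)"
    and N0: "N0 \<in> null_sets M" "\<And>x y. x \<notin> N0 \<Longrightarrow> (x, y) \<in> {(x, y). E x y} \<Longrightarrow> \<exists>n. (x, y) \<in> T n"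
    using borel_uniformization_ae[OF E_borel] AE_finite_degree by auto
  have sw: "prod.swap ` S \<in> sets borel" if "S \<in> sets borel" for S :: "('a \<times> 'a) set"
  proof -
    have "(prod.swap :: 'a \<times> 'a \<Rightarrow> 'a \<times> 'a) \<in> borel_measurable borel"
      by (intro borel_measurable_continuous_onI) (auto intro!: continuous_intros simp: prod.swap_def)
    then have "prod.swap -` S \<in> sets borel" using measurable_sets[of prod.swap borel borel S] that by simp
    moreover have "prod.swap ` S = prod.swap -` S" by (force simp: image_iff)
    ultimately show ?thesis by simp
  qed
  have "\<exists>R N1. (\<forall>m::nat. R m \<in> sets borel \<and> R m \<subseteq> T n \<and> inj_on snd (R m)) \<and> N1 \<in> null_sets M \<and>
    (\<forall>x y. y \<notin> N1 \<longrightarrow> (x, y) \<in> T n \<longrightarrow> (\<exists>m. (x, y) \<in> R m))" for n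
  proof -
    have "AE y in M. finite {x. (y, x) \<in> prod.swap ` T n}"
      using AE_finite_degree
    proof eventually_elim
      case (elim y)
      have "{x. (y, x) \<in> prod.swap ` T n} \<subseteq> {x. E y x}" using T(2) E_sym by fastforce
      then show ?case using elim by (rule finite_subset)
    qed
    then obtain R N1 where R: "\<And>m::nat. R m \<in> sets borel" "\<And>m. R m \<subseteq> prod.swap ` T n" "\<And>m. inj_on fst (R m)"
      "N1 \<in> null_sets M" "\<And>y x. y \<notin> N1 \<Longrightarrow> (y, x) \<in> prod.swap ` T n \<Longrightarrow> \<exists>m. (y, x) \<in> R m"
      using borel_uniformization_ae[OF sw[OF T(1)[of n]]] by blast
    have "prod.swap ` R m \<in> sets borel \<and> prod.swap ` R m \<subseteq> T n \<and> inj_on snd (prod.swap ` R m)" for m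
    proof (intro conjI)
      show "prod.swap ` R m \<subseteq> T n" using R(2)[of m] by auto
      show "inj_on snd (prod.swap ` R m)" using R(3)[of m] by (auto simp: inj_on_def)
    qed (intro sw R)
    moreover have "\<exists>m. (x, y) \<in> prod.swap ` R m" if y: "y \<notin> N1" "(x, y) \<in> T n" for x y
    proof -
      have "(y, x) \<in> prod.swap ` T n" using y(2) by force
      then obtain m where "(y, x) \<in> R m" using R(5) y(1) by blast
      then show ?thesis by force
    qed
    ultimately show ?thesis
      using R(4) by (intro exI[of _ "\<lambda>m. prod.swap ` R m"] exI[of _ N1]) simp
  qed
  then obtain R N1 where R: "\<And>n m::nat. R n m \<in> sets borel" "\<And>n m. R n m \<subseteq> T n" "\<And>n m. inj_on snd (R n m)"
    and N1: "\<And>n. N1 n \<in> null_sets M" "\<And>n x y. y \<notin> N1 n \<Longrightarrow> (x, y) \<in> T n \<Longrightarrow> \<exists>m. (x, y) \<in> R n m"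
    by metis
  \<comment> \<open>The second selection loses a null set of end points \<open>y\<close>;
    \<open>null_neighbours\<close> turns it into a null set of starting points
    \<open>x\<close>.\<close>
  have "(\<Union>n. N1 n) \<in> null_sets M" using N1 by (intro null_sets_UN) auto
  then obtain N2 where N2: "N2 \<in> null_sets M" "\<And>x y. x \<notin> N2 \<Longrightarrow> E x y \<Longrightarrow> y \<notin> (\<Union>n. N1 n)"
    using null_neighbours by blast
  have Rfst: "inj_on fst (R n m)" for n m by (rule inj_on_subset[OF T(3) R(2)])
  have "\<exists>F N3. (\<forall>k::nat. compact (F k) \<and> F k \<subseteq> R n m) \<and> N3 \<in> null_sets M \<and>
     (\<forall>x y. x \<notin> N3 \<longrightarrow> (x, y) \<in> R n m \<longrightarrow> (\<exists>k. (x, y) \<in> F k))" for n m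
  proof -
    have "continuous_on UNIV (fst :: 'a \<times> 'a \<Rightarrow> 'a)" by (intro continuous_intros)
    then obtain F U where F: "\<And>k::nat. compact (F k)" "\<And>k. F k \<subseteq> R n m"
      "U \<in> sets M" "fst ` R n m \<subseteq> U" "U - fst ` (\<Union>k. F k) \<in> null_sets M"
      using borel_image_sandwich[OF sets_M finite_measure_M _ R(1)[of n m], of fst] by blast
    \<comment> \<open>As \<open>R n m\<close> has at most one pair over \<open>x\<close>, a compact
      piece that meets this section contains the pair itself.\<close>
    have "\<exists>k. (x, y) \<in> F k" if x: "x \<notin> U - fst ` (\<Union>k. F k)" "(x, y) \<in> R n m" for x y
    proof -
      have "x \<in> U" using F(4) x(2) by force
      then obtain k y' where y': "(x, y') \<in> F k" using x(1) by auto
      then have "(x, y') = (x, y)" using F(2) x(2) by (intro inj_onD[OF Rfst]) auto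
      then show ?thesis using y' by auto
    qed
    then show ?thesis using F by blast
  qed
  then obtain F N3 where F: "\<And>n m k::nat. compact (F n m k)" "\<And>n m k. F n m k \<subseteq> R n m"
    and N3: "\<And>n m. N3 n m \<in> null_sets M"
       "\<And>n m x y. x \<notin> N3 n m \<Longrightarrow> (x, y) \<in> R n m \<Longrightarrow> \<exists>k. (x, y) \<in> F n m k"
    by metis
  obtain D :: nat where "AE x in M. finite {y. E x y} \<and> card {y. E x y} \<le> D"
    using bounded_degree by (auto simp: bounded_degree_def)
  then obtain N4 where N4: "N4 \<in> null_sets M" "\<And>x. x \<notin> N4 \<Longrightarrow> finite {y. E x y} \<and> card {y. E x y} \<le> D"
    by (auto simp: eventually_ae_filter space_M subset_iff)
  define G where "G i = (case (from_nat i :: nat \<times> nat \<times> nat) of (n, m, k) \<Rightarrow> F n m k)" for i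
  have G: "\<exists>n m k. G i = F n m k" for i
    unfolding G_def by (cases "from_nat i :: nat \<times> nat \<times> nat") auto
  let ?N = "N0 \<union> N2 \<union> (\<Union>n. \<Union>m. N3 n m) \<union> N4"
  show thesis
  proof (rule that[of G ?N D])
    fix i
    obtain n m k where i: "G i = F n m k" using G by blast
    show "compact (G i)" using F i by simp
    show "inj_on fst (G i)" "inj_on snd (G i)"
      unfolding i by (rule inj_on_subset[OF Rfst F(2)], rule inj_on_subset[OF R(3) F(2)])
    show "E x y" if "(x, y) \<in> G i" for x y
    proof -
      have "(x, y) \<in> T n" using that unfolding i by (intro subsetD[OF R(2)] subsetD[OF F(2)])
      then show ?thesis using T(2) by blast
    qed
  next
    show "?N \<in> null_sets M" using N0 N2 N3 N4 by (intro null_sets.Un null_sets_UN) auto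
    fix x y assume x: "x \<notin> ?N" "E x y"
    obtain n where n: "(x, y) \<in> T n" using N0(2)[of x y] x by auto
    have "y \<notin> N1 n" using N2(2)[of x y] x by blast
    then obtain m where m: "(x, y) \<in> R n m" using N1(2) n by blast
    have "x \<notin> N3 n m" using x(1) by simp
    then obtain k where k: "(x, y) \<in> F n m k" using N3(2)[OF _ m] by blast
    have "G (to_nat (n, m, k)) = F n m k" by (simp add: G_def)
    then show "\<exists>n. (x, y) \<in> G n" using k by blast
  qed (use N4 in auto)
qed

end

section \<open>The adjacency operator expressed by a fixed cover with partial bijections\<close>

locale edge_cover = pmp_borel_graph M E
  for M :: "'a::polish_space measure" and E +
  fixes F :: "nat \<Rightarrow> ('a \<times> 'a) set" and N :: "'a set" and D :: nat
  assumes F: "\<And>n. compact (F n)" "\<And>n x y. (x, y) \<in> F n \<Longrightarrow> E x y" "\<And>n. inj_on fst (F n)" "\<And>n. inj_on snd (F n)"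
    and N: "N \<in> null_sets M" and cover: "\<And>x y. x \<notin> N \<Longrightarrow> E x y \<Longrightarrow> \<exists>n. (x, y) \<in> F n"
    and deg: "\<And>x. x \<notin> N \<Longrightarrow> finite {y. E x y}" "\<And>x. x \<notin> N \<Longrightarrow> card {y. E x y} \<le> D"

text \<open>The constant value off the domain gives a map that is Borel on the whole space.\<close>

definition graph_map :: "('a \<times> 'b) set \<Rightarrow> 'a \<Rightarrow> 'b" where
  "graph_map F x = (if x \<in> fst ` F then graph_fun F x else undefined)"

lemma graph_map_iff:
  assumes "inj_on fst F"
  shows "(x, y) \<in> F \<longleftrightarrow> x \<in> fst ` F \<and> graph_map F x = y"
  unfolding graph_map_def graph_fun_iff[OF assms] by auto

lemma borel_measurable_graph_map:
  fixes F :: "('a::t2_space \<times> 'b::t2_space) set"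
  assumes "compact F" "inj_on fst F"
  shows "graph_map F \<in> borel_measurable borel"
proof -
  have "compact (fst ` F)" by (intro compact_continuous_image assms continuous_intros)
  then have "(\<lambda>x. if x \<in> fst ` F then graph_fun F x else undefined) \<in> borel_measurable borel"
    by (intro borel_measurable_continuous_on_if continuous_on_graph_fun assms) (auto intro: borel_compact)
  then show ?thesis by (simp add: graph_map_def[abs_def])
qed

context edge_cover
begin

definition g :: "nat \<Rightarrow> 'a \<Rightarrow> 'a" where "g n = graph_map (F n)"

text \<open>Each edge from \<open>x\<close> is assigned to the first \<open>F n\<close> that contains it.\<close>

definition dom :: "nat \<Rightarrow> 'a set" where
  "dom n = {x \<in> fst ` F n. \<forall>m<n. x \<in> fst ` F m \<longrightarrow> g m x \<noteq> g n x}"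

lemma g_measurable [measurable]: "g n \<in> borel_measurable borel"
  unfolding g_def by (intro borel_measurable_graph_map F)

lemma F_iff: "(x, y) \<in> F n \<longleftrightarrow> x \<in> fst ` F n \<and> g n x = y"
  unfolding g_def by (intro graph_map_iff F)

lemma fst_F_borel [measurable]: "fst ` F n \<in> sets borel"
  by (intro borel_compact compact_continuous_image F continuous_intros)

lemma dom_borel [measurable]: "dom n \<in> sets borel"
proof -
  obtain \<phi> :: "'a \<Rightarrow> real" where [measurable]: "\<phi> \<in> borel_measurable borel" and \<phi>: "inj \<phi>"
    by (rule injective_real_embedding)
  have "dom n = {x\<in>space borel. x \<in> fst ` F n \<and> (\<forall>m. m < n \<longrightarrow> x \<in> fst ` F m \<longrightarrow> \<phi> (g m x) \<noteq> \<phi> (g n x))}"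
    using \<phi> by (auto simp: dom_def inj_eq)
  also have "\<dots> \<in> sets borel" by measurable
  finally show ?thesis .
qed

lemma E_g: "x \<in> dom n \<Longrightarrow> E x (g n x)"
  using F(2)[of x "g n x" n] F_iff by (auto simp: dom_def)

lemma g_distinct:
  assumes "x \<in> dom m" "x \<in> dom n" "g m x = g n x" shows "m = n"
proof -
  have "\<not> m < n" if "x \<in> dom m" "x \<in> dom n" "g m x = g n x" for m n
    using that unfolding dom_def by blast
  from this[of m n] this[of n m] show ?thesis using assms by fastforce
qed

lemma neighbours_eq: 
  assumes "x \<notin> N" shows "{y. E x y} = (\<lambda>n. g n x) ` {n. x \<in> dom n}"
proof (intro equalityI subsetI)
  fix y assume "y \<in> {y. E x y}"
  then have ex: "\<exists>n. (x, y) \<in> F n" using cover assms by auto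
  define n where "n = (LEAST n. (x, y) \<in> F n)"
  have n: "(x, y) \<in> F n" unfolding n_def using ex by (rule LeastI_ex)
  have "(x, y) \<notin> F m" if "m < n" for m using not_less_Least that unfolding n_def by blast
  then have "x \<in> dom n" using n unfolding F_iff dom_def by auto
  then show "y \<in> (\<lambda>n. g n x) ` {n. x \<in> dom n}" using n unfolding F_iff by auto
qed (auto intro: E_g)

lemma finite_dom:
  assumes "x \<notin> N" shows "finite {n. x \<in> dom n}"
proof (rule finite_imageD)
  show "finite ((\<lambda>n. g n x) ` {n. x \<in> dom n})" using deg(1)[OF assms] neighbours_eq[OF assms] by simp
  show "inj_on (\<lambda>n. g n x) {n. x \<in> dom n}" by (auto intro!: inj_onI g_distinct)
qed

lemma sum_neighbours:
  fixes u :: "'a \<Rightarrow> 'b::comm_monoid_add"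
  assumes "x \<notin> N" shows "(\<Sum>y\<in>{y. E x y}. u y) = (\<Sum>n\<in>{n. x \<in> dom n}. u (g n x))"
  unfolding neighbours_eq[OF assms] by (subst sum.reindex) (auto intro!: inj_onI g_distinct)

text \<open>Neighbourhoods of points of \<open>N\<close> may be infinite and uncontrolled, so
  \<open>adj_op\<close> is replaced there by 0; this gives a version that is Borel
  everywhere.\<close>

definition T :: "('a \<Rightarrow> real) \<Rightarrow> 'a \<Rightarrow> real" where
  "T u x = (if x \<in> N then 0 else adj_op E u x)"

lemma N_borel [measurable]: "N \<in> sets borel"
  using N by (auto simp: sets_M)

lemma T_measurable [measurable]:
  assumes [measurable]: "u \<in> borel_measurable borel"
  shows "T u \<in> borel_measurable borel"
proof -
  have "T u x = (if x \<in> N then 0 else \<Sum>n. indicator (dom n) x * u (g n x))" for x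
  proof (cases "x \<in> N")
    case False
    then have "(\<Sum>n. indicator (dom n) x * u (g n x)) = (\<Sum>n\<in>{n. x \<in> dom n}. indicator (dom n) x * u (g n x))"
      by (intro suminf_finite finite_dom) auto
    then show ?thesis using False by (simp add: T_def adj_op_def sum_neighbours)
  qed (simp add: T_def)
  then have "T u = (\<lambda>x. if x \<in> N then 0 else \<Sum>n. indicator (dom n) x * u (g n x))" by blast
  also have "\<dots> \<in> borel_measurable borel" by measurable
  finally show ?thesis .
qed

text \<open>The image of \<open>dom n\<close> is its preimage under the inverse map, and that map is
  Borel because it comes from the swapped compact graph.\<close>

lemma g_image_borel [measurable]: "g n ` dom n \<in> sets borel"
proof -
  let ?G = "prod.swap ` F n"
  have cG: "compact ?G" using F(1)[of n] by (intro compact_continuous_image) (auto intro!: continuous_intros simp: prod.swap_def)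
  have iG: "inj_on fst ?G" using F(4)[of n] by (auto simp: inj_on_def)
  have [measurable]: "graph_map ?G \<in> borel_measurable borel" by (rule borel_measurable_graph_map[OF cG iG])
  have [measurable]: "fst ` ?G \<in> sets borel" by (intro borel_compact compact_continuous_image cG continuous_intros)
  have G: "(y, x) \<in> ?G \<longleftrightarrow> y \<in> fst ` ?G \<and> graph_map ?G y = x" for x y
    by (rule graph_map_iff[OF iG])
  have "g n ` dom n = {y\<in>space borel. y \<in> fst ` ?G \<and> graph_map ?G y \<in> dom n}"
  proof (intro equalityI subsetI)
    fix y assume "y \<in> g n ` dom n"
    then obtain x where x: "x \<in> dom n" "y = g n x" by blast
    then have "(x, y) \<in> F n" by (simp add: F_iff dom_def)
    then have "(y, x) \<in> ?G" by force
    then show "y \<in> {y\<in>space borel. y \<in> fst ` ?G \<and> graph_map ?G y \<in> dom n}" using x unfolding G by simp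
  next
    fix y assume "y \<in> {y\<in>space borel. y \<in> fst ` ?G \<and> graph_map ?G y \<in> dom n}"
    then have y: "y \<in> fst ` ?G" "graph_map ?G y \<in> dom n" by auto
    then have "(y, graph_map ?G y) \<in> ?G" using G by blast
    then have "(graph_map ?G y, y) \<in> F n" by auto
    then show "y \<in> g n ` dom n" using y(2) unfolding F_iff by (metis imageI)
  qed
  also have "\<dots> \<in> sets borel" by measurable
  finally show ?thesis .
qed

text \<open>The pmp property as a change of variables: \<open>g n\<close> transports the measure on
  \<open>dom n\<close> to the measure on the image.\<close>

lemma nn_integral_g:
  assumes [measurable]: "u \<in> borel_measurable borel"
  shows "(\<integral>\<^sup>+x. u (g n x) * indicator (dom n) x \<partial>M) = (\<integral>\<^sup>+y. u y * indicator (g n ` dom n) y \<partial>M)"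
proof -
  have inj: "inj_on (g n) (dom n)"
  proof (rule inj_onI)
    fix x x' assume "x \<in> dom n" "x' \<in> dom n" "g n x = g n x'"
    then have "(x, g n x) \<in> F n" "(x', g n x) \<in> F n" by (simp_all add: F_iff dom_def)
    then show "x = x'" using inj_onD[OF F(4)[of n]] by force
  qed
  have [measurable]: "dom n \<in> sets M" "g n ` dom n \<in> sets M" by (simp_all add: sets_M)
  have "distr (density M (indicator (dom n))) borel (g n) = density M (indicator (g n ` dom n))"
  proof (rule measure_eqI)
    fix B assume "B \<in> sets (distr (density M (indicator (dom n))) borel (g n))"
    then have [measurable]: "B \<in> sets borel" by simp
    have pre: "g n -` B \<in> sets borel" using measurable_sets[OF g_measurable, of B] by simp
    have "emeasure (distr (density M (indicator (dom n))) borel (g n)) B = emeasure M (dom n \<inter> g n -` B)"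
      using pre by (subst emeasure_distr) (auto simp: space_M sets_M emeasure_restricted)
    also have "\<dots> = emeasure M (graph_fun (F n) ` (dom n \<inter> g n -` B))"
      by (rule emeasure_graph_fun_image[symmetric])
        (use F pre in \<open>auto simp: sets_M dom_def\<close>)
    also have "graph_fun (F n) ` (dom n \<inter> g n -` B) = g n ` (dom n \<inter> g n -` B)"
      by (intro image_cong) (auto simp: g_def graph_map_def dom_def)
    also have "\<dots> = g n ` dom n \<inter> B" by auto
    also have "emeasure M \<dots> = emeasure (density M (indicator (g n ` dom n))) B"
      by (subst emeasure_restricted) (auto simp: sets_M)
    finally show "emeasure (distr (density M (indicator (dom n))) borel (g n)) B = emeasure (density M (indicator (g n ` dom n))) B" .
  qed (simp add: sets_M)
  then have "(\<integral>\<^sup>+y. u y \<partial>distr (density M (indicator (dom n))) borel (g n)) = (\<integral>\<^sup>+y. u y \<partial>density M (indicator (g n ` dom n)))"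
    by simp
  then show ?thesis
    by (simp add: nn_integral_distr nn_integral_density mult.commute)
qed

text \<open>Mass transport: moving every term to the other end of its edge counts \<open>u y\<close>
  once for each edge piece arriving at \<open>y\<close>. These edges start at distinct neighbours of
  \<open>y\<close>, so there are at most \<open>D\<close> of them.\<close>

lemma nn_integral_sum_neighbours_le:
  fixes u :: "'a \<Rightarrow> ennreal"
  assumes [measurable]: "u \<in> borel_measurable borel"
  shows "(\<integral>\<^sup>+x. (\<Sum>y\<in>{y. E x y}. u y) \<partial>M) \<le> D * (\<integral>\<^sup>+x. u x \<partial>M)"
proof -
  have notN: "AE x in M. x \<notin> N" using N by (rule AE_not_in)
  have [measurable]: "dom n \<in> sets M" "g n ` dom n \<in> sets M" for n by (simp_all add: sets_M)
  have "(\<integral>\<^sup>+x. (\<Sum>y\<in>{y. E x y}. u y) \<partial>M) = (\<integral>\<^sup>+x. (\<Sum>n. u (g n x) * indicator (dom n) x) \<partial>M)"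
  proof (rule nn_integral_cong_AE)
    show "AE x in M. (\<Sum>y\<in>{y. E x y}. u y) = (\<Sum>n. u (g n x) * indicator (dom n) x)"
      using notN
    proof eventually_elim
      case (elim x)
      have "(\<Sum>n. u (g n x) * indicator (dom n) x) = (\<Sum>n\<in>{n. x \<in> dom n}. u (g n x) * indicator (dom n) x)"
        using elim by (intro suminf_finite finite_dom) auto
      then show ?case using elim by (simp add: sum_neighbours)
    qed
  qed
  also have "\<dots> = (\<Sum>n. \<integral>\<^sup>+x. u (g n x) * indicator (dom n) x \<partial>M)"
    by (intro nn_integral_suminf) simp
  also have "\<dots> = (\<Sum>n. \<integral>\<^sup>+y. u y * indicator (g n ` dom n) y \<partial>M)"
    by (simp add: nn_integral_g)
  also have "\<dots> = (\<integral>\<^sup>+y. (\<Sum>n. u y * indicator (g n ` dom n) y) \<partial>M)"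
    by (intro nn_integral_suminf[symmetric]) simp
  also have "\<dots> \<le> (\<integral>\<^sup>+y. D * u y \<partial>M)"
  proof (rule nn_integral_mono_AE)
    show "AE y in M. (\<Sum>n. u y * indicator (g n ` dom n) y) \<le> D * u y"
      using notN
    proof eventually_elim
      case (elim y)
      have "(\<Sum>n<m. indicator (g n ` dom n) y :: ennreal) \<le> D" for m
      proof -
        \<comment> \<open>The pieces arriving at \<open>y\<close>. Two of them with the same
          starting point would represent the same edge, which \<open>g_distinct\<close>
          excludes.\<close>
        define I where "I = {n. n < m \<and> y \<in> g n ` dom n}"
        have "\<forall>n\<in>I. \<exists>x. x \<in> dom n \<and> g n x = y" by (auto simp: I_def)
        then obtain \<xi> where \<xi>: "\<And>n. n \<in> I \<Longrightarrow> \<xi> n \<in> dom n \<and> g n (\<xi> n) = y" by metis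
        have "inj_on \<xi> I" by (rule inj_onI) (metis \<xi> g_distinct)
        moreover have "\<xi> ` I \<subseteq> {x. E y x}" using \<xi> E_g E_sym by force
        ultimately have "card I \<le> card {x. E y x}" using deg(1)[OF elim] by (rule card_inj_on_le)
        then have "card I \<le> D" using deg(2)[OF elim] by simp
        moreover have "(\<Sum>n<m. indicator (g n ` dom n) y :: ennreal) = of_nat (card I)"
        proof -
          have "(\<Sum>n<m. indicator (g n ` dom n) y :: ennreal) = (\<Sum>n\<in>I. 1)"
            by (rule sum.mono_neutral_cong_right) (auto simp: I_def)
          then show ?thesis by simp
        qed
        ultimately show ?thesis by simp
      qed
      then have "(\<Sum>n. indicator (g n ` dom n) y :: ennreal) \<le> D"
        by (intro suminf_le_const) auto
      then have "u y * (\<Sum>n. indicator (g n ` dom n) y) \<le> u y * D"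
        by (intro mult_left_mono) auto
      then show ?case by (simp add: mult.commute)
    qed
  qed
  also have "\<dots> = D * (\<integral>\<^sup>+x. u x \<partial>M)" by (intro nn_integral_cmult) simp
  finally show ?thesis .
qed

lemma AE_notin_N: "AE x in M. x \<notin> N"
  using N by (rule AE_not_in)

lemma T_notin_N: "x \<notin> N \<Longrightarrow> T u x = (\<Sum>y\<in>{y. E x y}. u y)"
  by (simp add: T_def adj_op_def)

lemma T_integrable:
  assumes [measurable]: "u \<in> borel_measurable borel" and u: "integrable M u" "\<And>x. 0 \<le> u x"
  shows "integrable M (T u)" "(\<integral>x. T u x \<partial>M) \<le> D * (\<integral>x. u x \<partial>M)"
proof -
  have nonneg: "0 \<le> T u x" for x
    using u(2) by (simp add: T_def adj_op_def sum_nonneg)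
  have "(\<integral>\<^sup>+x. ennreal (T u x) \<partial>M) = (\<integral>\<^sup>+x. (\<Sum>y\<in>{y. E x y}. ennreal (u y)) \<partial>M)"
  proof (rule nn_integral_cong_AE)
    show "AE x in M. ennreal (T u x) = (\<Sum>y\<in>{y. E x y}. ennreal (u y))"
      using AE_notin_N by eventually_elim (simp add: T_notin_N u(2))
  qed
  also have "\<dots> \<le> D * (\<integral>\<^sup>+x. ennreal (u x) \<partial>M)"
    by (rule nn_integral_sum_neighbours_le) simp
  also have "\<dots> = ennreal (D * (\<integral>x. u x \<partial>M))"
    using u by (subst nn_integral_eq_integral) (auto simp: ennreal_mult integral_nonneg ennreal_of_nat_eq_real_of_nat)
  finally have le: "(\<integral>\<^sup>+x. ennreal (T u x) \<partial>M) \<le> ennreal (D * (\<integral>x. u x \<partial>M))" .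
  show int: "integrable M (T u)"
    unfolding integrable_iff_bounded
    using le nonneg by (auto intro: le_less_trans)
  have "ennreal (\<integral>x. T u x \<partial>M) \<le> ennreal (D * (\<integral>x. u x \<partial>M))"
    using le nonneg by (subst nn_integral_eq_integral[symmetric]) (auto intro: int)
  then show "(\<integral>x. T u x \<partial>M) \<le> D * (\<integral>x. u x \<partial>M)"
    using u(2) by (subst (asm) ennreal_le_iff) (auto simp: integral_nonneg)
qed

section \<open>The quadratic form and the Rayleigh quotients\<close>

definition B :: "('a \<Rightarrow> real) \<Rightarrow> real" where
  "B f = (\<integral>x. T f x * f x \<partial>M)"

text \<open>The inequality between a product and the mean of squares is applied edge by edge. The
  right-hand side is integrable by mass transport; it bounds the form by \<open>D\<close> and later
  dominates the truncated integrands.\<close>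

lemma abs_T_mult_le:
  fixes f :: "'a \<Rightarrow> real"
  shows "\<bar>T f x * f x\<bar> \<le> (D * (f x)\<^sup>2 + T (\<lambda>y. (f y)\<^sup>2) x) / 2"
proof (cases "x \<in> N")
  case False
  have "\<bar>T f x * f x\<bar> = \<bar>\<Sum>y\<in>{y. E x y}. f y * f x\<bar>"
    using False by (simp add: T_notin_N sum_distrib_right)
  also have "\<dots> \<le> (\<Sum>y\<in>{y. E x y}. \<bar>f y * f x\<bar>)" by (rule sum_abs)
  also have "\<dots> \<le> (\<Sum>y\<in>{y. E x y}. ((f x)\<^sup>2 + (f y)\<^sup>2) / 2)"
  proof (rule sum_mono)
    fix y
    have "2 * \<bar>f y\<bar> * \<bar>f x\<bar> \<le> \<bar>f y\<bar>\<^sup>2 + \<bar>f x\<bar>\<^sup>2" by (rule sum_squares_bound)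
    then show "\<bar>f y * f x\<bar> \<le> ((f x)\<^sup>2 + (f y)\<^sup>2) / 2" by (simp add: abs_mult)
  qed
  also have "\<dots> = (card {y. E x y} * (f x)\<^sup>2 + T (\<lambda>y. (f y)\<^sup>2) x) / 2"
    using False by (simp add: T_notin_N sum.distrib flip: sum_divide_distrib)
  also have "\<dots> \<le> (D * (f x)\<^sup>2 + T (\<lambda>y. (f y)\<^sup>2) x) / 2"
    using deg(2)[OF False] by (intro divide_right_mono add_right_mono mult_right_mono) auto
  finally show ?thesis .
qed (simp add: T_def)

lemma
  fixes f :: "'a \<Rightarrow> real"
  assumes [measurable]: "f \<in> borel_measurable borel" and f: "integrable M (\<lambda>x. (f x)\<^sup>2)"
  shows T_mult_bound_integrable: "integrable M (\<lambda>x. (D * (f x)\<^sup>2 + T (\<lambda>y. (f y)\<^sup>2) x) / 2)"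
    and T_mult_integrable: "integrable M (\<lambda>x. T f x * f x)"
    and abs_B_le: "\<bar>B f\<bar> \<le> D * (\<integral>x. (f x)\<^sup>2 \<partial>M)"
proof -
  have T2: "integrable M (T (\<lambda>y. (f y)\<^sup>2))" "(\<integral>x. T (\<lambda>y. (f y)\<^sup>2) x \<partial>M) \<le> D * (\<integral>x. (f x)\<^sup>2 \<partial>M)"
    using f by (intro T_integrable; simp)+
  show 1: "integrable M (\<lambda>x. (D * (f x)\<^sup>2 + T (\<lambda>y. (f y)\<^sup>2) x) / 2)"
    using f T2 by (intro integrable_divide integrable_add integrable_mult_right) auto
  show "integrable M (\<lambda>x. T f x * f x)"
  proof (rule Bochner_Integration.integrable_bound[OF 1])
    have "norm (T f x * f x) \<le> norm ((D * (f x)\<^sup>2 + T (\<lambda>y. (f y)\<^sup>2) x) / 2)" for x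
      using abs_T_mult_le[of f x] unfolding real_norm_def by linarith
    then show "AE x in M. norm (T f x * f x) \<le> norm ((D * (f x)\<^sup>2 + T (\<lambda>y. (f y)\<^sup>2) x) / 2)"
      by blast
  qed simp
  have "\<bar>B f\<bar> \<le> (\<integral>x. \<bar>T f x * f x\<bar> \<partial>M)" unfolding B_def by (rule integral_abs_bound)
  also have "\<dots> \<le> (\<integral>x. (D * (f x)\<^sup>2 + T (\<lambda>y. (f y)\<^sup>2) x) / 2 \<partial>M)"
    using 1 \<open>integrable M (\<lambda>x. T f x * f x)\<close> abs_T_mult_le by (intro integral_mono) auto
  also have "\<dots> = (D * (\<integral>x. (f x)\<^sup>2 \<partial>M) + (\<integral>x. T (\<lambda>y. (f y)\<^sup>2) x \<partial>M)) / 2"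
    using f T2 by simp
  also have "\<dots> \<le> D * (\<integral>x. (f x)\<^sup>2 \<partial>M)" using T2(2) by simp
  finally show "\<bar>B f\<bar> \<le> D * (\<integral>x. (f x)\<^sup>2 \<partial>M)" .
qed

text \<open>The quotient of \<open>f\<close> is 0 if \<open>adj_op E f\<close> fails to be measurable on the exceptional null set.\<close>

lemma rayleigh_quotients_cases:
  assumes "r \<in> rayleigh_quotients M E"
  obtains "r = 0" | f :: "'a \<Rightarrow> real" where "f \<in> borel_measurable borel" "integrable M (\<lambda>x. (f x)\<^sup>2)" "(\<integral>x. (f x)\<^sup>2 \<partial>M) \<noteq> 0"
    "r = B f / (\<integral>x. (f x)\<^sup>2 \<partial>M)"
proof -
  obtain f where f: "f \<in> borel_measurable borel" "integrable M (\<lambda>x. (f x)\<^sup>2)" "(\<integral>x. (f x)\<^sup>2 \<partial>M) \<noteq> 0"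
    and r: "r = (\<integral>x. adj_op E f x * f x \<partial>M) / (\<integral>x. (f x)\<^sup>2 \<partial>M)"
    using assms by (auto simp: rayleigh_quotients_def)
  have [measurable]: "f \<in> borel_measurable borel" by fact
  show thesis
  proof (cases "(\<lambda>x. adj_op E f x * f x) \<in> borel_measurable M")
    case True
    have "(\<integral>x. adj_op E f x * f x \<partial>M) = B f"
      unfolding B_def
    proof (rule integral_cong_AE[OF True])
      show "AE x in M. adj_op E f x * f x = T f x * f x"
        using AE_notin_N by eventually_elim (simp add: T_def)
    qed simp
    then show thesis using f r by (intro that(2)[of f]) auto
  next
    case False
    then have "\<not> integrable M (\<lambda>x. adj_op E f x * f x)" by (auto dest: borel_measurable_integrable)
    then show thesis using r by (intro that(1)) (simp add: not_integrable_integral_eq)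
  qed
qed

text \<open>\<open>adj_op E f\<close> may fail to be measurable because of points in
  \<open>N\<close>. Setting \<open>f\<close> to 0 on \<open>N\<close> makes the products with
  \<open>adj_op\<close> and with \<open>T\<close> agree at every point, and
  \<open>AE_neighbours\<close> shows that the form is unchanged.\<close>

lemma B_in_rayleigh_quotients:
  fixes f :: "'a \<Rightarrow> real"
  assumes [measurable]: "f \<in> borel_measurable borel"
    and f: "integrable M (\<lambda>x. (f x)\<^sup>2)" "(\<integral>x. (f x)\<^sup>2 \<partial>M) \<noteq> 0"
  shows "B f / (\<integral>x. (f x)\<^sup>2 \<partial>M) \<in> rayleigh_quotients M E"
proof -
  define f' where "f' x = (if x \<in> N then 0 else f x)" for x
  have [measurable]: "f' \<in> borel_measurable borel" unfolding f'_def by measurable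
  have sq: "AE x in M. (f' x)\<^sup>2 = (f x)\<^sup>2"
    using AE_notin_N by eventually_elim (simp add: f'_def)
  have sq': "(\<integral>x. (f' x)\<^sup>2 \<partial>M) = (\<integral>x. (f x)\<^sup>2 \<partial>M)"
    by (rule integral_cong_AE[OF _ _ sq]) simp_all
  have int: "integrable M (\<lambda>x. (f' x)\<^sup>2)"
    using f(1) by (subst integrable_cong_AE[OF _ _ sq]) simp_all
  have "(\<integral>x. adj_op E f' x * f' x \<partial>M) = (\<integral>x. T f' x * f' x \<partial>M)"
    by (rule arg_cong[where f="lebesgue_integral M"]) (auto simp: T_def f'_def)
  also have "\<dots> = B f"
    unfolding B_def
  proof (rule integral_cong_AE)
    show "AE x in M. T f' x * f' x = T f x * f x"
      using AE_notin_N AE_neighbours[OF AE_notin_N]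
    proof eventually_elim
      case (elim x)
      then have "T f' x = T f x"
        unfolding T_notin_N[OF elim(1)] by (intro sum.cong) (auto simp: f'_def)
      then show ?case using elim by (simp add: f'_def)
    qed
  qed simp_all
  finally have "B f / (\<integral>x. (f x)\<^sup>2 \<partial>M) = (\<integral>x. adj_op E f' x * f' x \<partial>M) / (\<integral>x. (f' x)\<^sup>2 \<partial>M)"
    using sq' by simp
  moreover have "(\<integral>x. (f' x)\<^sup>2 \<partial>M) \<noteq> 0" using f(2) sq' by simp
  ultimately show ?thesis
    using int unfolding rayleigh_quotients_def measurable_M_eq
    by (intro CollectI exI[of _ f']) simp
qed

lemma abs_rayleigh_quotients_le:
  assumes "r \<in> rayleigh_quotients M E" shows "\<bar>r\<bar> \<le> D"
  using assms
proof (cases rule: rayleigh_quotients_cases)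
  case (2 f)
  have "0 \<le> (\<integral>x. (f x)\<^sup>2 \<partial>M)" by simp
  then have "0 < (\<integral>x. (f x)\<^sup>2 \<partial>M)" using 2(3) by linarith
  then show ?thesis
    unfolding 2(4) abs_divide using abs_B_le[OF 2(1,2)] by (simp add: divide_le_eq)
qed simp

lemma B_ge_spec_min:
  fixes f :: "'a \<Rightarrow> real"
  assumes f: "f \<in> borel_measurable borel" "integrable M (\<lambda>x. (f x)\<^sup>2)"
  shows "spec_min M E * (\<integral>x. (f x)\<^sup>2 \<partial>M) \<le> B f"
proof (cases "(\<integral>x. (f x)\<^sup>2 \<partial>M) = 0")
  case True
  then show ?thesis using abs_B_le[OF f] by simp
next
  case False
  have "0 \<le> (\<integral>x. (f x)\<^sup>2 \<partial>M)" by simp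
  then have pos: "0 < (\<integral>x. (f x)\<^sup>2 \<partial>M)" using False by linarith
  have "bdd_below (rayleigh_quotients M E)"
    using abs_rayleigh_quotients_le by (intro bdd_belowI[of _ "- real D"]) force
  then have "spec_min M E \<le> B f / (\<integral>x. (f x)\<^sup>2 \<partial>M)"
    unfolding spec_min_def by (intro cInf_lower B_in_rayleigh_quotients f False)
  then show ?thesis using pos by (simp add: field_simps)
qed

end

section \<open>The spectral inequality for approximate colourings\<close>

text \<open>The weights for \<open>a\<close> form the vector (1,...,1) - k e_a; its inner product
  with the one for \<open>b\<close> is k - k - k.\<close>

lemma sum_weights_distinct:
  fixes k a b :: nat
  assumes "a < k" "b < k" "a \<noteq> b"
  shows "(\<Sum>j<k. (if a = j then 1 - real k else 1) * (if b = j then 1 - real k else 1)) = - real k"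
proof -
  have "(\<Sum>j<k. (if a = j then 1 - real k else 1) * (if b = j then 1 - real k else 1))
    = (\<Sum>j<k. 1 - (if a = j then real k else 0) - (if b = j then real k else 0))"
    using assms by (intro sum.cong) auto
  also have "\<dots> = - real k"
    using assms by (simp add: sum_subtractf)
  finally show ?thesis .
qed

text \<open>With equal indices the term for e_a contributes as well: k - 2k + k^2.\<close>

lemma sum_weights_square:
  fixes k a :: nat
  assumes "a < k"
  shows "(\<Sum>j<k. (if a = j then 1 - real k else 1)\<^sup>2) = real k * (real k - 1)"
proof -
  have "(\<Sum>j<k. (if a = j then 1 - real k else 1)\<^sup>2)
    = (\<Sum>j<k. 1 + (if a = j then (1 - real k)\<^sup>2 - 1 else 0))"
    by (intro sum.cong) auto
  also have "\<dots> = real k * (real k - 1)"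
    using assms by (simp add: sum.distrib power2_eq_square algebra_simps)
  finally show ?thesis .
qed

context edge_cover
begin

text \<open>Hoffman's argument: multiplying \<open>f\<close> by \<open>1 - k\<close> on one colour class gives \<open>k\<close> test
  functions whose quadratic forms sum to \<open>- k * B f\<close> and whose squared norms sum to
  \<open>k * (k - 1)\<close> times that of \<open>f\<close>.\<close>

lemma B_le_if_colored_support:
  fixes f :: "'a \<Rightarrow> real"
  assumes col: "measurable_proper_coloring_on M E A k" and k: "0 < k"
    and [measurable]: "f \<in> borel_measurable borel" and f: "integrable M (\<lambda>x. (f x)\<^sup>2)" "\<And>x. x \<notin> A \<Longrightarrow> f x = 0"
  shows "B f \<le> - spec_min M E * (real k - 1) * (\<integral>x. (f x)\<^sup>2 \<partial>M)"
proof -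
  obtain c where c: "c \<in> completion M \<rightarrow>\<^sub>M count_space UNIV" "\<And>x. x \<in> A \<Longrightarrow> c x < k"
    "\<And>x y. x \<in> A \<Longrightarrow> y \<in> A \<Longrightarrow> E x y \<Longrightarrow> c x \<noteq> c y"
    using col by (auto simp: measurable_proper_coloring_on_def)
  have "(\<lambda>x. real (c x)) \<in> borel_measurable (completion M)"
    using c(1) by (rule measurable_compose) simp
  \<comment> \<open>The colouring is measurable only for the completion, so the test functions use a
    Borel version that agrees with it almost everywhere.\<close>
  then obtain c' where c'm: "c' \<in> borel_measurable M" and c': "AE x in M. real (c x) = c' x"
    using completion_ex_borel_measurable_real by blast
  have [measurable]: "c' \<in> borel_measurable borel" using c'm by simp
  define h where "h j x = f x * (if c' x = real j then 1 - real k else 1)" for j x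
  have [measurable]: "h j \<in> borel_measurable borel" for j unfolding h_def by measurable
  have hint: "integrable M (\<lambda>x. (h j x)\<^sup>2)" for j
  proof (rule Bochner_Integration.integrable_bound)
    show "integrable M (\<lambda>x. (real k)\<^sup>2 * (f x)\<^sup>2)" using f by simp
    have "(h j x)\<^sup>2 \<le> (real k)\<^sup>2 * (f x)\<^sup>2" for x
    proof -
      have "(if c' x = real j then 1 - real k else 1)\<^sup>2 \<le> (real k)\<^sup>2"
        using k by (auto simp: power2_le_iff_abs_le)
      then show ?thesis
        unfolding h_def power_mult_distrib by (subst mult.commute) (rule mult_right_mono, auto)
    qed
    then show "AE x in M. norm ((h j x)\<^sup>2) \<le> norm ((real k)\<^sup>2 * (f x)\<^sup>2)" by simp
  qed simp
  have "(\<Sum>j<k. B (h j)) = (\<integral>x. (\<Sum>j<k. T (h j) x * h j x) \<partial>M)"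
    unfolding B_def by (rule Bochner_Integration.integral_sum[symmetric]) (simp add: T_mult_integrable hint)
  also have "\<dots> = (\<integral>x. - real k * (T f x * f x) \<partial>M)"
  proof (rule integral_cong_AE)
    show "AE x in M. (\<Sum>j<k. T (h j) x * h j x) = - real k * (T f x * f x)"
      \<comment> \<open>The Borel version must agree with the colouring at \<open>x\<close> and at
        all neighbours of \<open>x\<close>, since both ends of an edge enter.\<close>
      using AE_notin_N c' AE_neighbours[OF c']
    proof eventually_elim
      case (elim x)
      have "(\<Sum>j<k. h j y * h j x) = - real k * (f y * f x)" if y: "E x y" for y
      proof (cases "x \<in> A \<and> y \<in> A")
        case True
        have cc: "c' x = real (c x)" "c' y = real (c y)" using elim y by auto
        have "(\<Sum>j<k. h j y * h j x) = (f y * f x) * (\<Sum>j<k. (if c y = j then 1 - real k else 1) * (if c x = j then 1 - real k else 1))"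
          unfolding h_def cc sum_distrib_left by (intro sum.cong) auto
        also have "\<dots> = (f y * f x) * (- real k)"
          using True y c(2,3) E_sym by (subst sum_weights_distinct) auto
        finally show ?thesis by simp
      next
        case False
        then show ?thesis using f(2) by (auto simp: h_def)
      qed
      then have "(\<Sum>y\<in>{y. E x y}. \<Sum>j<k. h j y * h j x) = (\<Sum>y\<in>{y. E x y}. - real k * (f y * f x))"
        by (intro sum.cong) auto
      moreover have "(\<Sum>j<k. T (h j) x * h j x) = (\<Sum>y\<in>{y. E x y}. \<Sum>j<k. h j y * h j x)"
        unfolding T_notin_N[OF elim(1)] sum_distrib_right by (rule sum.swap)
      ultimately show ?case
        unfolding T_notin_N[OF elim(1)] by (simp add: sum_distrib_left sum_distrib_right)
    qed
  qed (simp_all add: T_mult_integrable)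
  also have "\<dots> = - real k * B f" unfolding B_def by simp
  finally have 1: "(\<Sum>j<k. B (h j)) = - real k * B f" .
  have "(\<Sum>j<k. \<integral>x. (h j x)\<^sup>2 \<partial>M) = (\<integral>x. (\<Sum>j<k. (h j x)\<^sup>2) \<partial>M)"
    by (rule Bochner_Integration.integral_sum[symmetric]) (rule hint)
  also have "\<dots> = (\<integral>x. real k * (real k - 1) * (f x)\<^sup>2 \<partial>M)"
  proof (rule integral_cong_AE)
    show "AE x in M. (\<Sum>j<k. (h j x)\<^sup>2) = real k * (real k - 1) * (f x)\<^sup>2"
      using c'
    proof eventually_elim
      case (elim x)
      show ?case
      proof (cases "x \<in> A")
        case True
        have cc: "c' x = real (c x)" using elim by simp
        have "(\<Sum>j<k. (h j x)\<^sup>2) = (f x)\<^sup>2 * (\<Sum>j<k. (if c x = j then 1 - real k else 1)\<^sup>2)"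
          unfolding h_def cc sum_distrib_left power_mult_distrib by (intro sum.cong) auto
        then show ?thesis using sum_weights_square[OF c(2)[OF True]] by simp
      qed (simp add: h_def f)
    qed
  qed simp_all
  also have "\<dots> = real k * (real k - 1) * (\<integral>x. (f x)\<^sup>2 \<partial>M)" by simp
  finally have 2: "(\<Sum>j<k. \<integral>x. (h j x)\<^sup>2 \<partial>M) = real k * (real k - 1) * (\<integral>x. (f x)\<^sup>2 \<partial>M)" .
  have "spec_min M E * (\<Sum>j<k. \<integral>x. (h j x)\<^sup>2 \<partial>M) \<le> (\<Sum>j<k. B (h j))"
    unfolding sum_distrib_left by (intro sum_mono B_ge_spec_min hint) simp
  then have "real k * B f \<le> real k * (- spec_min M E * (real k - 1) * (\<integral>x. (f x)\<^sup>2 \<partial>M))"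
    unfolding 1 2 by (simp add: algebra_simps)
  then show ?thesis using k by (subst (asm) mult_le_cancel_left_pos) simp
qed

lemma approx_colorable_pos:
  assumes "approx_colorable M E k" shows "0 < k"
proof -
  obtain A where A: "measure M A > 1 - 1" "measurable_proper_coloring_on M E A k"
    using assms unfolding approx_colorable_def by (metis zero_less_one)
  then have "A \<noteq> {}" by auto
  then show ?thesis using A(2) by (force simp: measurable_proper_coloring_on_def)
qed

text \<open>For the indicator of a coloured set of positive measure, the form lies between m times
  and -m (k - 1) times its squared norm, whence m k is at most 0. This sign is needed when norms are
  enlarged and when dividing by m.\<close>

lemma spec_min_nonpos:
  assumes "approx_colorable M E k" shows "spec_min M E \<le> 0"
proof -
  obtain A where A: "A \<in> sets M" "measure M A > 1 - 1" "measurable_proper_coloring_on M E A k"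
    using assms unfolding approx_colorable_def by (metis zero_less_one)
  have [measurable]: "A \<in> sets borel" using A(1) by (simp add: sets_M)
  have sq: "(\<lambda>x. (indicator A x :: real)\<^sup>2) = indicator A" by (auto simp: indicator_def)
  have f: "integrable M (\<lambda>x. (indicator A x :: real)\<^sup>2)" "(\<integral>x. (indicator A x :: real)\<^sup>2 \<partial>M) = measure M A"
    unfolding sq using A(1) by (simp_all add: space_M less_top[symmetric])
  have k: "0 < k" using assms by (rule approx_colorable_pos)
  have "B (indicator A) \<le> - spec_min M E * (real k - 1) * measure M A"
    using B_le_if_colored_support[OF A(3) k, of "indicator A"] f by simp
  moreover have "spec_min M E * measure M A \<le> B (indicator A)"
    using B_ge_spec_min[of "indicator A"] f by simp
  ultimately have "(spec_min M E * k) * measure M A \<le> 0 * measure M A" by (simp add: algebra_simps)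
  then have "spec_min M E * k \<le> 0" using A(2) by (subst (asm) mult_le_cancel_right) simp
  then show ?thesis using k by (simp add: mult_le_0_iff)
qed

text \<open>Truncating \<open>f\<close> to the coloured sets \<open>A n\<close> makes the integrand
  eventually constant at almost every \<open>x\<close>: \<open>x\<close> and its finitely many
  neighbours eventually lie in \<open>A n\<close>. Dominated convergence then carries the bound over
  to \<open>f\<close>.\<close>

lemma B_le_if_approx_colorable:
  fixes f :: "'a \<Rightarrow> real"
  assumes col: "approx_colorable M E k"
    and [measurable]: "f \<in> borel_measurable borel" and f: "integrable M (\<lambda>x. (f x)\<^sup>2)"
  shows "B f \<le> - spec_min M E * (real k - 1) * (\<integral>x. (f x)\<^sup>2 \<partial>M)"
proof -
  have k: "0 < k" using col by (rule approx_colorable_pos)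
  \<comment> \<open>The errors are summable, so by Borel-Cantelli almost every point lies in all but
    finitely many of the sets, which need not be increasing.\<close>
  have "\<exists>A\<in>sets M. measure M A > 1 - (1/2) ^ n \<and> measurable_proper_coloring_on M E A k" for n :: nat
    using col unfolding approx_colorable_def by simp
  then obtain A where A: "\<And>n::nat. A n \<in> sets M" "\<And>n. measure M (A n) > 1 - (1/2) ^ n"
    "\<And>n. measurable_proper_coloring_on M E (A n) k" by metis
  have [measurable]: "A n \<in> sets borel" for n using A(1) by (simp add: sets_M)
  have ev: "AE x in M. eventually (\<lambda>n. x \<in> A n) sequentially"
  proof -
    have le: "measure M (space M - A n) \<le> (1/2) ^ n" for n
      using A(2)[of n] prob_compl[OF A(1)] by simp
    have "AE x in M. eventually (\<lambda>n. x \<in> space M - (space M - A n)) sequentially"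
    proof (rule borel_cantelli_AE1)
      show "summable (\<lambda>n. measure M (space M - A n))"
        by (rule summable_comparison_test'[of "\<lambda>n. (1/2) ^ n" 0]) (use le in \<open>auto simp: summable_geometric\<close>)
    qed (use A(1) in \<open>auto simp: less_top[symmetric]\<close>)
    then show ?thesis by eventually_elim (auto elim!: eventually_mono)
  qed
  define fn where "fn n x = indicator (A n) x * f x" for n x
  have [measurable]: "fn n \<in> borel_measurable borel" for n unfolding fn_def by measurable
  have fn_sq: "(fn n x)\<^sup>2 \<le> (f x)\<^sup>2" for n x by (auto simp: fn_def indicator_def)
  have fn_int: "integrable M (\<lambda>x. (fn n x)\<^sup>2)" for n
    by (rule Bochner_Integration.integrable_bound[OF f]) (use fn_sq in auto)
  have le: "B (fn n) \<le> - spec_min M E * (real k - 1) * (\<integral>x. (f x)\<^sup>2 \<partial>M)" for n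
  proof -
    have "B (fn n) \<le> - spec_min M E * (real k - 1) * (\<integral>x. (fn n x)\<^sup>2 \<partial>M)"
      using fn_int by (intro B_le_if_colored_support[OF A(3)[of n] k]) (auto simp: fn_def)
    also have "\<dots> \<le> - spec_min M E * (real k - 1) * (\<integral>x. (f x)\<^sup>2 \<partial>M)"
    proof (rule mult_left_mono)
      show "(\<integral>x. (fn n x)\<^sup>2 \<partial>M) \<le> (\<integral>x. (f x)\<^sup>2 \<partial>M)"
        by (intro integral_mono fn_int f fn_sq)
      show "0 \<le> - spec_min M E * (real k - 1)"
        using spec_min_nonpos[OF col] k by (intro mult_nonneg_nonneg) auto
    qed
    finally show ?thesis .
  qed
  have "(\<lambda>n. B (fn n)) \<longlonglongrightarrow> B f"
    unfolding B_def
  proof (rule integral_dominated_convergence)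
    show "integrable M (\<lambda>x. (D * (f x)\<^sup>2 + T (\<lambda>y. (f y)\<^sup>2) x) / 2)"
      using f by (intro T_mult_bound_integrable) simp
    show "AE x in M. (\<lambda>n. T (fn n) x * fn n x) \<longlonglongrightarrow> T f x * f x"
      using AE_notin_N ev AE_neighbours[OF ev]
    proof eventually_elim
      case (elim x)
      have "\<forall>y\<in>{y. E x y}. eventually (\<lambda>n. y \<in> A n) sequentially" using elim(3) by blast
      then have "eventually (\<lambda>n. \<forall>y\<in>{y. E x y}. y \<in> A n) sequentially"
        by (rule eventually_ball_finite[OF deg(1)[OF elim(1)]])
      then have "eventually (\<lambda>n. T (fn n) x * fn n x = T f x * f x) sequentially"
        using elim(2)
        by eventually_elim (auto simp: T_notin_N[OF elim(1)] fn_def intro!: sum.cong)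
      then show ?case by (rule tendsto_eventually)
    qed
    show "AE x in M. norm (T (fn n) x * fn n x) \<le> (D * (f x)\<^sup>2 + T (\<lambda>y. (f y)\<^sup>2) x) / 2" for n
    proof (rule AE_I2)
      fix x
      have "T (\<lambda>y. (fn n y)\<^sup>2) x \<le> T (\<lambda>y. (f y)\<^sup>2) x"
        by (auto simp: T_def adj_op_def intro!: sum_mono fn_sq)
      moreover have "D * (fn n x)\<^sup>2 \<le> D * (f x)\<^sup>2" by (intro mult_left_mono fn_sq) simp
      ultimately have "(D * (fn n x)\<^sup>2 + T (\<lambda>y. (fn n y)\<^sup>2) x) / 2 \<le> (D * (f x)\<^sup>2 + T (\<lambda>y. (f y)\<^sup>2) x) / 2"
        by (intro divide_right_mono add_mono) simp_all
      with abs_T_mult_le[of "fn n" x] show "norm (T (fn n) x * fn n x) \<le> (D * (f x)\<^sup>2 + T (\<lambda>y. (f y)\<^sup>2) x) / 2"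
        unfolding real_norm_def by (rule order_trans)
    qed
  qed simp_all
  then show ?thesis by (rule LIMSEQ_le_const2) (use le in blast)
qed

end

section \<open>Existence of approximate colourings\<close>

context edge_cover
begin

text \<open>The finitely many neighbours of a point form a closed set, so some basic open set
  contains the point and none of them. Removing from a basic open set the points with a neighbour in
  it leaves an independent set.\<close>

lemma countable_independent_cover:
  obtains I :: "nat \<Rightarrow> 'a set" where "\<And>i. I i \<in> sets M" "\<And>i x y. x \<in> I i \<Longrightarrow> y \<in> I i \<Longrightarrow> \<not> E x y"
    "AE x in M. x \<in> (\<Union>i. I i)"
proof -
  obtain B :: "'a set set" where B: "countable B" "\<And>C. C \<in> B \<Longrightarrow> open C"
    "\<And>S. open S \<Longrightarrow> \<exists>U. U \<subseteq> B \<and> S = \<Union>U"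
    using univ_second_countable by blast
  obtain U :: "nat \<Rightarrow> 'a set" where U: "insert {} B = range U"
    using B(1) by (metis countable_insert insert_not_empty uncountable_def)
  have Uo: "open (U n)" for n
    using B(2) U by (metis insertE open_empty rangeI)
  \<comment> \<open>The first projection of \<open>Z i\<close> is the set to be removed from
    \<open>U i\<close>; it need not be Borel, so the hull \<open>V i\<close> is removed instead, at
    the cost of a null set.\<close>
  define Z where "Z i = {(x, y). E x y} \<inter> (U i \<times> U i)" for i
  have "Z i \<in> sets borel" for i
    unfolding Z_def using Uo by (intro sets.Int E_borel borel_open open_Times)
  then have "\<exists>V N. V \<in> sets M \<and> fst ` Z i \<subseteq> V \<and> N \<in> null_sets M \<and> V - fst ` Z i \<subseteq> N" for i
    using borel_projection_null by metis
  then obtain V N' where V: "\<And>i. V i \<in> sets M" "\<And>i. fst ` Z i \<subseteq> V i"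
    and N': "\<And>i. N' i \<in> null_sets M" "\<And>i. V i - fst ` Z i \<subseteq> N' i" by metis
  have "(\<Union>i. N' i) \<in> null_sets M" using N'(1) by (intro null_sets_UN) auto
  then have AE: "AE x in M. x \<notin> (\<Union>i. N' i)" by (rule AE_not_in)
  show thesis
  proof (rule that[of "\<lambda>i. U i - V i"])
    show "U i - V i \<in> sets M" for i using Uo V(1) by (auto simp: sets_M)
    show "\<not> E x y" if "x \<in> U i - V i" "y \<in> U i - V i" for i x y
    proof
      assume "E x y"
      then have "(x, y) \<in> Z i" using that by (auto simp: Z_def)
      then show False using that V(2)[of i] by force
    qed
    show "AE x in M. x \<in> (\<Union>i. U i - V i)"
      using AE AE_finite_degree
    proof eventually_elim
      case (elim x)
      have "open (- {y. E x y})" using elim(2) finite_imp_closed by (simp add: open_closed)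
      from B(3)[OF this] obtain \<W> where \<W>: "\<W> \<subseteq> B" "- {y. E x y} = \<Union>\<W>" by blast
      have "x \<in> - {y. E x y}" using E_irrefl by simp
      then obtain W where "W \<in> \<W>" "x \<in> W" unfolding \<W>(2) by blast
      then have W: "W \<in> B" "x \<in> W" "W \<subseteq> - {y. E x y}" using \<W> by blast+
      then have "W \<in> range U" using U by blast
      then obtain i where i: "W = U i" by blast
      have "x \<notin> fst ` Z i" using W(3) i by (auto simp: Z_def)
      then have "x \<notin> V i" using N'(2)[of i] elim(1) by blast
      then show ?case using W(2) i by blast
    qed
  qed
qed

text \<open>\<open>I n\<close> is independent, so all its new points can be coloured at once, each
  by the least colour absent from its neighbours coloured earlier. At most \<open>D\<close>
  neighbours leave one of \<open>Suc D\<close> colours free.\<close>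

lemma greedy_coloring:
  fixes I :: "nat \<Rightarrow> 'a set"
  assumes I: "\<And>i. I i \<in> sets M" "\<And>i x y. x \<in> I i \<Longrightarrow> y \<in> I i \<Longrightarrow> \<not> E x y"
  shows "\<exists>c::'a \<Rightarrow> nat. c \<in> borel \<rightarrow>\<^sub>M count_space UNIV \<and> (\<forall>x\<in>(\<Union>i<n. I i) - N. c x < Suc D) \<and>
    (\<forall>x\<in>(\<Union>i<n. I i) - N. \<forall>y\<in>(\<Union>i<n. I i) - N. E x y \<longrightarrow> c x \<noteq> c y)"
proof (induction n)
  case 0
  show ?case by (intro exI[of _ "\<lambda>_. 0"]) auto
next
  case (Suc n)
  from Suc.IH obtain c :: "'a \<Rightarrow> nat" where cm [measurable]: "c \<in> borel \<rightarrow>\<^sub>M count_space UNIV"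
    and c0: "\<forall>x\<in>(\<Union>i<n. I i) - N. c x < Suc D"
      "\<forall>x\<in>(\<Union>i<n. I i) - N. \<forall>y\<in>(\<Union>i<n. I i) - N. E x y \<longrightarrow> c x \<noteq> c y"
    by (elim exE conjE)
  note c = c0(1)[rule_format] c0(2)[rule_format]
  define W where "W = (\<Union>i<n. I i)"
  have [measurable]: "W \<in> sets borel" using I(1) unfolding W_def sets_M by auto
  \<comment> \<open>The indicator of the points already coloured \<open>j\<close>. Off
    \<open>N\<close>, vanishing of \<open>T (u j)\<close> says that \<open>j\<close> does not occur
    next to \<open>x\<close>, which is thereby a Borel condition.\<close>
  define u :: "nat \<Rightarrow> 'a \<Rightarrow> real" where "u j x = (if x \<in> W \<and> c x = j then 1 else 0)" for j x
  have [measurable]: "u j \<in> borel_measurable borel" for j unfolding u_def by measurable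
  have T0: "T (u j) x = 0 \<longleftrightarrow> (\<forall>y. E x y \<longrightarrow> y \<in> W \<longrightarrow> c y \<noteq> j)" if "x \<notin> N" for x j
    unfolding T_notin_N[OF that] using deg(1)[OF that]
    by (subst sum_nonneg_eq_0_iff) (auto simp: u_def)
  define c' where "c' x = (if x \<in> W then c x else (LEAST j. T (u j) x = 0))" for x
  have c'm: "c' \<in> borel \<rightarrow>\<^sub>M count_space UNIV"
    unfolding c'_def by measurable
  have ex: "\<exists>j<Suc D. T (u j) x = 0" if x: "x \<notin> N" for x
  proof -
    have "card (c ` {y. E x y}) < card {..<Suc D}"
      using card_image_le[OF deg(1)[OF x], of c] deg(2)[OF x] by simp
    then have "\<not> {..<Suc D} \<subseteq> c ` {y. E x y}"
      using deg(1)[OF x] by (meson card_mono finite_imageI leD)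
    then show ?thesis unfolding T0[OF x] by blast
  qed
  have least: "T (u (c' x)) x = 0" "c' x < Suc D" if x: "x \<notin> N" "x \<notin> W" for x
  proof -
    obtain j where j: "j < Suc D" "T (u j) x = 0" using ex[OF x(1)] by blast
    have eq: "c' x = (LEAST j. T (u j) x = 0)" using x(2) by (simp add: c'_def)
    show "T (u (c' x)) x = 0" unfolding eq using j(2) by (rule LeastI)
    have "(LEAST j. T (u j) x = 0) \<le> j" using j(2) by (rule Least_le)
    then show "c' x < Suc D" unfolding eq using j(1) by simp
  qed
  have W': "(\<Union>i<Suc n. I i) = W \<union> I n" by (auto simp: W_def less_Suc_eq)
  have new: "c' x \<noteq> c' y" if "x \<notin> N" "x \<notin> W" "y \<in> W" "E x y" for x y
    using least(1)[OF that(1,2)] that unfolding T0[OF that(1)] by (auto simp: c'_def)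
  have "c' x < Suc D" if "x \<in> (\<Union>i<Suc n. I i) - N" for x
  proof (cases "x \<in> W")
    case True
    then show ?thesis using c(1)[of x] that by (simp add: c'_def W_def)
  qed (use least(2) that in auto)
  moreover have "c' x \<noteq> c' y" if x: "x \<in> (\<Union>i<Suc n. I i) - N" and y: "y \<in> (\<Union>i<Suc n. I i) - N" and xy: "E x y" for x y
  proof -
    consider "x \<in> W" "y \<in> W" | "x \<notin> W" "y \<in> W" | "x \<in> W" "y \<notin> W" | "x \<in> I n" "y \<in> I n"
      using x y unfolding W' by blast
    then show ?thesis
    proof cases
      case 1
      then show ?thesis using c(2)[of x y] x y xy by (simp add: c'_def W_def)
    next
      case 2
      then show ?thesis using new x xy by blast
    next
      case 3
      then show ?thesis using new[of y x] y E_sym[OF xy] by auto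
    next
      case 4
      then show ?thesis using I(2) xy by blast
    qed
  qed
  ultimately show ?case using c'm by (intro exI[of _ c'] conjI ballI impI)
qed

text \<open>Finitely many of the independent sets fill the space up to \<epsilon>, and
  \<open>greedy_coloring\<close> colours their union off \<open>N\<close>.\<close>

lemma approx_colorable_degree: "approx_colorable M E (Suc D)"
  unfolding approx_colorable_def
proof (intro allI impI)
  fix \<epsilon> :: real assume \<epsilon>: "0 < \<epsilon>"
  obtain I :: "nat \<Rightarrow> 'a set" where I: "\<And>i. I i \<in> sets M" "\<And>i x y. x \<in> I i \<Longrightarrow> y \<in> I i \<Longrightarrow> \<not> E x y"
    "AE x in M. x \<in> (\<Union>i. I i)"
    using countable_independent_cover by metis
  define W where "W n = (\<Union>i<n. I i) - N" for n
  have Wm: "W n \<in> sets M" for n unfolding W_def using I(1) N by auto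
  have "incseq W"
    unfolding incseq_def W_def by (intro allI impI Diff_mono UN_mono) auto
  then have "(\<lambda>n. measure M (W n)) \<longlonglongrightarrow> measure M (\<Union>n. W n)"
    by (intro finite_Lim_measure_incseq) (use Wm in auto)
  moreover have "measure M (\<Union>n. W n) = 1"
  proof (rule prob_eq_1[THEN iffD2])
    show "AE x in M. x \<in> (\<Union>n. W n)"
      using I(3) AE_notin_N by eventually_elim (auto simp: W_def)
  qed (use Wm in auto)
  ultimately have "eventually (\<lambda>n. measure M (W n) > 1 - \<epsilon>) sequentially"
    using \<epsilon> by (intro order_tendstoD(1)) auto
  then obtain n where n: "measure M (W n) > 1 - \<epsilon>"
    by (auto simp: eventually_sequentially)
  have "\<exists>c::'a \<Rightarrow> nat. c \<in> borel \<rightarrow>\<^sub>M count_space UNIV \<and> (\<forall>x\<in>W n. c x < Suc D) \<and>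
    (\<forall>x\<in>W n. \<forall>y\<in>W n. E x y \<longrightarrow> c x \<noteq> c y)"
    unfolding W_def by (rule greedy_coloring[of I n, OF I(1)]) (rule I(2))
  then obtain c :: "'a \<Rightarrow> nat" where c: "c \<in> borel \<rightarrow>\<^sub>M count_space UNIV" "\<forall>x\<in>W n. c x < Suc D"
    "\<forall>x\<in>W n. \<forall>y\<in>W n. E x y \<longrightarrow> c x \<noteq> c y"
    by (elim exE conjE)
  have "c \<in> completion M \<rightarrow>\<^sub>M count_space UNIV"
    using c(1) by (intro measurable_completion) simp
  then have "measurable_proper_coloring_on M E (W n) (Suc D)"
    using c(2,3) unfolding measurable_proper_coloring_on_def by blast
  then show "\<exists>A\<in>sets M. 1 - \<epsilon> < measure M A \<and> measurable_proper_coloring_on M E A (Suc D)"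
    using n Wm by blast
qed

section \<open>From the bound on the quadratic form to the chromatic number\<close>

lemma chi_ap_ge: "of_int \<lceil>1 - spec_max M E / spec_min M E\<rceil> \<le> real (chi_ap M E)"
proof -
  define k where "k = chi_ap M E"
  define m where "m = spec_min M E"
  have k: "approx_colorable M E k"
    unfolding k_def chi_ap_def using approx_colorable_degree by (rule LeastI)
  have k1: "1 \<le> k" using approx_colorable_pos[OF k] by simp
  have m0: "m \<le> 0" unfolding m_def using k by (rule spec_min_nonpos)
  have nonneg: "0 \<le> - m * (real k - 1)" using m0 k1 by (intro mult_nonneg_nonneg) auto
  have "spec_max M E \<le> - m * (real k - 1)"
    unfolding spec_max_def
  proof (rule cSup_least)
    \<comment> \<open>The constant function 1 provides a Rayleigh quotient, as the upper bound on
      \<open>Sup\<close> requires a nonempty set.\<close>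
    have "B (\<lambda>_. 1) / (\<integral>x. 1\<^sup>2 \<partial>M) \<in> rayleigh_quotients M E"
      by (rule B_in_rayleigh_quotients) (simp_all add: prob_space)
    then show "rayleigh_quotients M E \<noteq> {}" by blast
    fix r assume "r \<in> rayleigh_quotients M E"
    then show "r \<le> - m * (real k - 1)"
    proof (cases rule: rayleigh_quotients_cases)
      case 1
      then show ?thesis using nonneg by simp
    next
      case (2 f)
      have "0 \<le> (\<integral>x. (f x)\<^sup>2 \<partial>M)" by simp
      then have "0 < (\<integral>x. (f x)\<^sup>2 \<partial>M)" using 2(3) by linarith
      then show ?thesis
        unfolding 2(4) m_def using B_le_if_approx_colorable[OF k 2(1,2)] by (simp add: divide_le_eq)
    qed
  qed
  \<comment> \<open>If m is 0, division by 0 gives 0 and the claim is that at least one colour is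
    needed; otherwise the inequality is divided by the negative number m.\<close>
  then have "1 - spec_max M E / m \<le> real k"
    using m0 k1 by (cases "m = 0") (auto simp: field_simps)
  then show ?thesis
    unfolding m_def k_def by (metis ceiling_le_iff of_int_of_nat_eq of_int_le_iff)
qed

end

theorem theorem6p7:
  fixes M :: "'a::polish_space measure" and E :: "'a \<Rightarrow> 'a \<Rightarrow> bool"
  assumes "prob_space M" and "sets M = sets borel"
    and "borel_graph M E" and "bounded_degree M E" and "pmp_graph M E"
  shows "real (chi_ap M E) \<ge> of_int \<lceil>1 - spec_max M E / spec_min M E\<rceil>"
proof -
  interpret prob_space M by fact
  interpret pmp_borel_graph M E by unfold_locales fact+
  obtain F N D where F: "\<And>n::nat. compact (F n)" "\<And>n x y. (x, y) \<in> F n \<Longrightarrow> E x y" "\<And>n. inj_on fst (F n)"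
    "\<And>n. inj_on snd (F n)" "N \<in> null_sets M" "\<And>x y. x \<notin> N \<Longrightarrow> E x y \<Longrightarrow> \<exists>n. (x, y) \<in> F n"
    "\<And>x. x \<notin> N \<Longrightarrow> finite {y. E x y}" "\<And>x. x \<notin> N \<Longrightarrow> card {y. E x y} \<le> D"
    by (rule partial_bijection_cover) blast
  interpret edge_cover M E F N D by unfold_locales (fact F)+
  show ?thesis by (rule chi_ap_ge)
qed

end
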